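(* Let $G$ be a finite, simple, connected and planar graph with $r = \mathrm{girth}(G) = \mathrm{circum}(G)$. Let $\mathcal{F}_1,\ldots,\mathcal{F}_m$ be the strict face components of $G$. If $r$ is even, then for each $i$ either $\mathcal{F}_i \cong B\left(\frac{r}{2},r,p\right)$ for some $p \geq 2$ (possibly depending on $i$) or $\mathcal{F}_i \cong C_r$. If $r$ is odd, then $\mathcal{F}_i \cong C_r$ for each $i$.
   Context: For a graph $G$ containing at least one cycle, $\mathrm{girth}(G)$ and $\mathrm{circum}(G)$ are the lengths of a shortest and of a longest cycle in $G$; they are defined only for graphs containing a cycle, so the hypothesis entails that $G$ contains a cycle. $C_r$ is the cycle graph on $r$ vertices. Faces. Fix a plane representation (embedding in $\mathbb{R}^2$) of $G$. "Face" means internal face, i.e. a bounded connected component of the complement of the plane representation in $\mathbb{R}^2$. The cycle bounding a face $F$ is the unique cycle of $G$ contained in the boundary of $F$ and having $F$ in its interior. Two faces are adjacent if the cycles bounding them share at least one edge. Two faces $F,F'$ are connected if there is a sequence of faces $F_1=F,\ldots,F_m=F'$ with $F_k$ adjacent to $F_{k+1}$ for all $1\le k\le m-1$. The strict face component $G_F$ containing a face $F$ is the subgraph of $G$ consisting of the vertices and edges of the cycles bounding the faces connected to $F$. Generalised book graph. For $L\ge 3$, $1\le n\le L-2$, $p\ge 2$, the graph $B(n,L,p)$ is the graph obtained from $p$ cycles of length $L$ by gluing them together along a common path of length $n$ (i.e. two vertices joined by $p+1$ internally disjoint paths, one of length $n$ and $p$ of length $L-n$). *)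

theory Defs
  imports "Graph_Theory.Graph_Theory" "HOL-Analysis.Analysis"
begin

text \<open>
  Finite simple graphs are rendered by the locale \<open>pair_graph\<close>: symmetric, loop-free digraphs
  without parallel arcs, an undirected edge \<open>uv\<close> being the pair of arcs \<open>(u, v)\<close> and \<open>(v, u)\<close>.
\<close>

section \<open>Cycles, girth and circumference\<close>

text \<open>
  The bound on the length excludes the closed walks \<open>u v u\<close>, which the digraph notion of cycle admits.
\<close>

definition graph_cycle :: "'a pair_pre_digraph \<Rightarrow> ('a \<times> 'a) awalk \<Rightarrow> bool" where
  "graph_cycle G p \<longleftrightarrow> pre_digraph.cycle (with_proj G) p \<and> 3 \<le> length p"

definition cycle_lengths :: "'a pair_pre_digraph \<Rightarrow> nat set" where
  "cycle_lengths G = {length p | p. graph_cycle G p}"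

text \<open>Both are meaningful only for finite graphs containing a cycle.\<close>

definition girth :: "'a pair_pre_digraph \<Rightarrow> nat" where
  "girth G = Min (cycle_lengths G)"

definition circum :: "'a pair_pre_digraph \<Rightarrow> nat" where
  "circum G = Max (cycle_lengths G)"

text \<open>
  The cycles of a graph as subgraphs, so that rotating or reversing the closed walk does not matter.
  Every vertex of a closed walk is the tail of one of its arcs.
\<close>

definition cycle_subgraphs :: "'a pair_pre_digraph \<Rightarrow> 'a pair_pre_digraph set" where
  "cycle_subgraphs G =
     {\<lparr> pverts = fst ` set p, parcs = set p \<union> (set p)\<inverse> \<rparr> | p. graph_cycle G p}"

section \<open>The graphs $C_r$ and $B(n,L,p)$\<close>

definition cycle_graph :: "nat \<Rightarrow> nat pair_pre_digraph" where
  "cycle_graph r =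
     (let A = {(j, Suc j mod r) | j. j < r}
      in \<lparr> pverts = {..<r}, parcs = A \<union> A\<inverse> \<rparr>)"

text \<open>
  Vertex \<open>j\<close> of the \<open>i\<close>-th copy of \<open>C\<^sub>L\<close> is \<open>(i, j)\<close>; the paths \<open>0, \<dots>, n\<close> of all copies are
  identified with the one of copy \<open>0\<close>.
\<close>

definition book_glue :: "nat \<Rightarrow> nat \<times> nat \<Rightarrow> nat \<times> nat" where
  "book_glue n = (\<lambda>(i, j). if j \<le> n then (0, j) else (i, j))"

text \<open>Intended for \<open>3 \<le> L\<close>, \<open>1 \<le> n\<close>, \<open>n \<le> L - 2\<close> and \<open>2 \<le> p\<close>.\<close>

definition book_graph :: "nat \<Rightarrow> nat \<Rightarrow> nat \<Rightarrow> (nat \<times> nat) pair_pre_digraph" where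
  "book_graph n L p =
     (let A = {(book_glue n (i, j), book_glue n (i, Suc j mod L)) | i j. i < p \<and> j < L}
      in \<lparr> pverts = book_glue n ` ({..<p} \<times> {..<L}), parcs = A \<union> A\<inverse> \<rparr>)"

section \<open>Plane representations and faces\<close>

text \<open>
  The plane is the type of complex numbers, for which the library has the Jordan curve theorem.
  Vertices are drawn as distinct points and edges as arcs between their end vertices; an edge meets
  no other vertex, and two distinct edges meet at most in vertices.  The two orientations of an edge
  are drawn as the same arc.
\<close>

definition plane_representation ::
    "'a pair_pre_digraph \<Rightarrow> ('a \<Rightarrow> complex) \<Rightarrow> ('a \<times> 'a \<Rightarrow> real \<Rightarrow> complex) \<Rightarrow> bool" where
  "plane_representation G pos \<gamma> \<longleftrightarrow>
     inj_on pos (pverts G) \<and>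
     (\<forall>(u, v) \<in> parcs G.
        arc (\<gamma> (u, v)) \<and> pathstart (\<gamma> (u, v)) = pos u \<and> pathfinish (\<gamma> (u, v)) = pos v \<and>
        \<gamma> (v, u) = reversepath (\<gamma> (u, v)) \<and>
        path_image (\<gamma> (u, v)) \<inter> pos ` pverts G = {pos u, pos v}) \<and>
     (\<forall>e \<in> parcs G. \<forall>e' \<in> parcs G. e' \<noteq> e \<and> e' \<noteq> prod.swap e \<longrightarrow>
        path_image (\<gamma> e) \<inter> path_image (\<gamma> e') \<subseteq> pos ` pverts G)"

definition drawing ::
    "'a pair_pre_digraph \<Rightarrow> ('a \<Rightarrow> complex) \<Rightarrow> ('a \<times> 'a \<Rightarrow> real \<Rightarrow> complex) \<Rightarrow> complex set" where
  "drawing G pos \<gamma> = pos ` pverts G \<union> (\<Union>e \<in> parcs G. path_image (\<gamma> e))"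

definition faces ::
    "'a pair_pre_digraph \<Rightarrow> ('a \<Rightarrow> complex) \<Rightarrow> ('a \<times> 'a \<Rightarrow> real \<Rightarrow> complex) \<Rightarrow> complex set set" where
  "faces G pos \<gamma> = {F \<in> components (- drawing G pos \<gamma>). bounded F}"

definition bounding_cycle ::
    "'a pair_pre_digraph \<Rightarrow> ('a \<Rightarrow> complex) \<Rightarrow> ('a \<times> 'a \<Rightarrow> real \<Rightarrow> complex) \<Rightarrow> complex set \<Rightarrow>
     'a pair_pre_digraph" where
  "bounding_cycle G pos \<gamma> F =
     (THE C. C \<in> cycle_subgraphs G \<and> drawing C pos \<gamma> \<subseteq> frontier F \<and> F \<subseteq> inside (drawing C pos \<gamma>))"

definition face_adjacency ::
    "'a pair_pre_digraph \<Rightarrow> ('a \<Rightarrow> complex) \<Rightarrow> ('a \<times> 'a \<Rightarrow> real \<Rightarrow> complex) \<Rightarrow> complex set rel" where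
  "face_adjacency G pos \<gamma> =
     {(F, F'). F \<in> faces G pos \<gamma> \<and> F' \<in> faces G pos \<gamma> \<and>
        parcs (bounding_cycle G pos \<gamma> F) \<inter> parcs (bounding_cycle G pos \<gamma> F') \<noteq> {}}"

definition strict_face_component ::
    "'a pair_pre_digraph \<Rightarrow> ('a \<Rightarrow> complex) \<Rightarrow> ('a \<times> 'a \<Rightarrow> real \<Rightarrow> complex) \<Rightarrow> complex set \<Rightarrow>
     'a pair_pre_digraph" where
  "strict_face_component G pos \<gamma> F =
     (let \<F> = {F'. (F, F') \<in> (face_adjacency G pos \<gamma>)\<^sup>*}
      in \<lparr> pverts = (\<Union>F' \<in> \<F>. pverts (bounding_cycle G pos \<gamma> F')),
           parcs = (\<Union>F' \<in> \<F>. parcs (bounding_cycle G pos \<gamma> F')) \<rparr>)"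

definition strict_face_components ::
    "'a pair_pre_digraph \<Rightarrow> ('a \<Rightarrow> complex) \<Rightarrow> ('a \<times> 'a \<Rightarrow> real \<Rightarrow> complex) \<Rightarrow>
     'a pair_pre_digraph set" where
  "strict_face_components G pos \<gamma> = strict_face_component G pos \<gamma> ` faces G pos \<gamma>"

end

theory Submission
  imports Defs
begin

text \<open>
  Janiszewski's theorem supplies all the planarity needed. If a set of edges separates two points,
  one removes an edge \<open>e\<close>: when \<open>e\<close> lies on a cycle \<open>C\<close>, the drawings of \<open>C\<close> and of the remaining
  edges meet in the drawing of the path \<open>C - e\<close>, which is connected, so one of the two still
  separates; when \<open>e\<close> is a bridge, the pieces meet in single points. Hence some cycle separates.
  Applied to a point of a face and a point far away, this shows that the frontier of every face
  contains a cycle around the face, and comparing outsides shows that this cycle is unique.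

  The rest uses no planarity. A strict face component is a union of cycles of length \<open>r\<close>, connected
  through shared edges. An ear added to a cycle of length \<open>r\<close> must have the same length as both arcs
  between its ends, which makes \<open>r\<close> even and yields a book with three pages; an ear added to a
  book must join the two hubs, since any other pair of vertices is joined by paths of different
  lengths.
\<close>

section \<open>Unions of cycles of equal length\<close>

text \<open>In B(r/2, r, p) the glued path is as long as the p others: the graph consists of p + 1
  internally disjoint paths of length r/2 between two hubs, none of them distinguished. In this
  symmetric form an ear is just one more path, and the choice of a common path is postponed to the
  final isomorphism. Subgraphs are handled through their sets of arcs; nothing is lost, because
  cycles, books and their unions have no isolated vertices, so that \<open>Field\<close> recovers
  the vertices.

  On the plane side the obstacle is that a cycle separating a face from infinity need not lie in the
  frontier of the face. Separation is therefore applied only to those edges that meet the frontier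
  in a point other than a vertex; an edge of this kind on a cycle around the face lies in the
  frontier entirely. Existence and uniqueness are both needed because the bounding cycle is given by
  a definite description.\<close>

fun edges :: "'a list \<Rightarrow> ('a \<times> 'a) set" where
  "edges [] = {}"
| "edges [x] = {}"
| "edges (x # y # zs) = insert (x, y) (insert (y, x) (edges (y # zs)))"

abbreviation cedges :: "'a list \<Rightarrow> ('a \<times> 'a) set" where
  "cedges c \<equiv> edges (c @ [hd c])"

lemma edges_append: "edges (xs @ y # zs) = edges (xs @ [y]) \<union> edges (y # zs)"
  by (induction xs rule: edges.induct) auto

lemma edges_rev: "edges (rev xs) = edges xs"
proof (induction xs rule: edges.induct)
  case (3 x y zs)
  then show ?case using edges_append[of "rev zs" y "[x]"] by auto
qed auto

lemma sym_edges: "sym (edges xs)"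
  by (induction xs rule: edges.induct) (auto simp: sym_def)

lemma finite_edges [simp]: "finite (edges xs)"
  by (induction xs rule: edges.induct) auto

lemma edges_subset: "edges xs \<subseteq> set xs \<times> set xs"
  by (induction xs rule: edges.induct) auto

lemma Field_edges: "2 \<le> length xs \<Longrightarrow> Field (edges xs) = set xs"
proof (induction xs rule: edges.induct)
  case (3 x y zs)
  then show ?case by (cases zs) (auto simp: Field_def)
qed auto

lemma edges_split:
  assumes "(a, b) \<in> edges xs"
  shows "(\<exists>p s. xs = p @ a # b # s) \<or> (\<exists>p s. xs = p @ b # a # s)"
  using assms
proof (induction xs rule: edges.induct)
  case (3 x y zs)
  consider "(a, b) = (x, y)" | "(a, b) = (y, x)" | "(a, b) \<in> edges (y # zs)"
    using 3 by auto
  then show ?case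
  proof cases
    case 3
    then show ?thesis using "3.IH" by (metis append_Cons)
  qed fastforce+
qed auto

lemma edges_sublist: "edges xs \<subseteq> edges (p @ xs @ s)"
proof (cases xs)
  case (Cons x ys)
  have "edges (x # ys) \<subseteq> edges (x # ys @ s)"
  proof (cases ys rule: rev_cases)
    case Nil then show ?thesis by simp
  next
    case (snoc zs z)
    then show ?thesis using edges_append[of "x # zs" z s] by auto
  qed
  then show ?thesis using Cons edges_append[of p x "ys @ s"] by auto
qed simp

text \<open>Bridge to the index form in which \<open>cycle_graph\<close> and
  \<open>book_graph\<close> list their arcs.\<close>

lemma edges_conv_nth:
  "edges xs = {(xs ! i, xs ! Suc i) | i. Suc i < length xs} \<union> {(xs ! i, xs ! Suc i) | i. Suc i < length xs}\<inverse>"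
proof (induction xs rule: edges.induct)
  case (3 x y zs)
  have "{((x # y # zs) ! i, (x # y # zs) ! Suc i) | i. Suc i < length (x # y # zs)} =
        insert (x, y) {((y # zs) ! i, (y # zs) ! Suc i) | i. Suc i < length (y # zs)}" (is "?L = ?R")
  proof
    show "?L \<subseteq> ?R"
    proof
      fix e assume "e \<in> ?L"
      then obtain i where "e = ((x # y # zs) ! i, (x # y # zs) ! Suc i)" "Suc i < length (x # y # zs)"
        by blast
      then show "e \<in> ?R" by (cases i) auto
    qed
    show "?R \<subseteq> ?L" by force
  qed
  then show ?case using 3 by auto
qed auto

lemma cedges_rotate: "cedges (xs @ ys) = cedges (ys @ xs)"
proof (cases "xs = [] \<or> ys = []")
  case False
  then obtain x xs' y ys' where "xs = x # xs'" "ys = y # ys'" by (meson neq_Nil_conv)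
  then show ?thesis
    using edges_append[of "x # xs'" y "ys' @ [x]"] edges_append[of "y # ys'" x "xs' @ [y]"] by auto
qed auto

section \<open>Cycles and paths as lists of vertices\<close>

definition is_cycle :: "('a \<times> 'a) set \<Rightarrow> 'a list \<Rightarrow> bool" where
  "is_cycle E c \<longleftrightarrow> distinct c \<and> 3 \<le> length c \<and> cedges c \<subseteq> E"

text \<open>In \<open>is_path E x zs y\<close>, the list \<open>zs\<close> contains the interior vertices only.\<close>

definition is_path :: "('a \<times> 'a) set \<Rightarrow> 'a \<Rightarrow> 'a list \<Rightarrow> 'a \<Rightarrow> bool" where
  "is_path E x zs y \<longleftrightarrow> distinct (x # zs @ [y]) \<and> edges (x # zs @ [y]) \<subseteq> E"

lemma is_path_rev: "is_path E x zs y \<longleftrightarrow> is_path E y (rev zs) x"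
  using edges_rev[of "x # zs @ [y]"] by (auto simp: is_path_def)

lemma is_path_mono: "is_path A x zs y \<Longrightarrow> A \<subseteq> E \<Longrightarrow> is_path E x zs y"
  by (auto simp: is_path_def)

lemma is_path_append:
  assumes "is_path E x ys y" "is_path E y zs z" "set (x # ys) \<inter> set (zs @ [z]) = {}"
  shows "is_path E x (ys @ y # zs) z"
  using assms edges_append[of "x # ys" y "zs @ [z]"] by (auto simp: is_path_def)

lemma is_path_appendD:
  assumes "is_path E x (ys @ y # zs) z"
  shows "is_path E x ys y" "is_path E y zs z"
  using assms edges_append[of "x # ys" y "zs @ [z]"] by (auto simp: is_path_def)

lemma is_path_Field: "is_path A x zs y \<Longrightarrow> insert x (insert y (set zs)) \<subseteq> Field A"
  using Field_edges[of "x # zs @ [y]"] mono_Field[of "edges (x # zs @ [y])" A]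
  by (auto simp: is_path_def)

text \<open>The last hypothesis excludes two copies of the single edge from \<open>x\<close> to
  \<open>y\<close>, which would close up to a walk of length two.\<close>

lemma is_cycle_of_paths:
  assumes "is_path E x ys y" "is_path E x zs y" "set ys \<inter> set zs = {}" "ys \<noteq> [] \<or> zs \<noteq> []"
  shows "is_cycle E (x # ys @ y # rev zs)"
proof -
  have "1 \<le> length ys + length zs" using assms(4) by (cases ys; cases zs) auto
  then show ?thesis
    using assms edges_append[of "x # ys" y "rev zs @ [x]"] edges_rev[of "x # zs @ [y]"]
    by (auto simp: is_path_def is_cycle_def)
qed

lemma Field_cedges: "is_cycle E c \<Longrightarrow> Field (cedges c) = set c"
  by (cases c) (auto simp: is_cycle_def Field_edges)

text \<open>This is B(m, 2m, p) with p = \<open>card P - 1\<close> in symmetric form: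
  \<open>P\<close> holds the interiors of all paths between the hubs, the glued one included. Thus
  three pages correspond to two glued cycles, and a page of \<open>m\<close> edges is a list of
  \<open>m - 1\<close> vertices.\<close>

definition is_book :: "nat \<Rightarrow> 'a \<Rightarrow> 'a \<Rightarrow> 'a list set \<Rightarrow> ('a \<times> 'a) set \<Rightarrow> bool" where
  "is_book m u v P A \<longleftrightarrow>
     2 \<le> m \<and> finite P \<and> 3 \<le> card P \<and> A = (\<Union>xs\<in>P. edges (u # xs @ [v])) \<and>
     (\<forall>xs\<in>P. Suc (length xs) = m \<and> is_path A u xs v) \<and>
     (\<forall>xs\<in>P. \<forall>ys\<in>P. xs \<noteq> ys \<longrightarrow> set xs \<inter> set ys = {})"

lemma is_bookD:
  assumes "is_book m u v P A"
  shows "2 \<le> m" "finite P" "3 \<le> card P" "A = (\<Union>xs\<in>P. edges (u # xs @ [v]))"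
    "xs \<in> P \<Longrightarrow> Suc (length xs) = m" "xs \<in> P \<Longrightarrow> is_path A u xs v"
    "xs \<in> P \<Longrightarrow> ys \<in> P \<Longrightarrow> xs \<noteq> ys \<Longrightarrow> set xs \<inter> set ys = {}"
  by (insert assms[unfolded is_book_def], (elim conjE, (assumption | erule bspec | blast))+)

lemma is_book_swap:
  assumes "is_book m u v P A"
  shows "is_book m v u (rev ` P) A"
proof -
  have "edges (v # rev xs @ [u]) = edges (u # xs @ [v])" for xs
    using edges_rev[of "u # xs @ [v]"] by simp
  then have "A = (\<Union>xs\<in>rev ` P. edges (v # xs @ [u]))" using is_bookD(4)[OF assms] by simp
  moreover have "card (rev ` P) = card P" by (simp add: card_image)
  moreover have "is_path A v xs u" if "xs \<in> rev ` P" for xs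
    using that is_bookD(6)[OF assms] is_path_rev by fast
  moreover have "set xs \<inter> set ys = {}" if "xs \<in> rev ` P" "ys \<in> rev ` P" "xs \<noteq> ys" for xs ys
    using that is_bookD(7)[OF assms] by (elim imageE) (metis set_rev)
  ultimately show ?thesis
    using is_bookD(1-3,5)[OF assms] unfolding is_book_def by (intro conjI ballI impI) auto
qed

lemma Field_book:
  assumes "is_book m u v P A"
  shows "Field A = {u, v} \<union> (\<Union>xs\<in>P. set xs)"
proof -
  have "P \<noteq> {}" using is_bookD(3)[OF assms] by auto
  have "Field A = (\<Union>xs\<in>P. Field (edges (u # xs @ [v])))"
    using is_bookD(4)[OF assms] unfolding Field_def by blast
  also have "\<dots> = (\<Union>xs\<in>P. set (u # xs @ [v]))" using Field_edges by (metis (no_types, lifting)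
     Suc_le_mono length_Cons length_append_singleton numeral_2_eq_2 le0)
  finally show ?thesis using \<open>P \<noteq> {}\<close> by auto
qed

lemma third_page:
  assumes "3 \<le> card P"
  obtains ws where "ws \<in> P" "ws \<noteq> ys" "ws \<noteq> zs"
proof -
  have "card {ys, zs} \<le> 2" by (simp add: card_insert_if)
  then have "\<not> P \<subseteq> {ys, zs}"
    using assms card_mono[of "{ys, zs}" P] by auto
  then show thesis using that by blast
qed

section \<open>Path lengths between vertices of a book\<close>

context
  fixes m :: nat and u v :: 'a and P :: "'a list set" and A :: "('a \<times> 'a) set"
  assumes bk: "is_book m u v P A"
begin

lemma page: "xs \<in> P \<Longrightarrow> is_path A u xs v" "xs \<in> P \<Longrightarrow> Suc (length xs) = m"
  using is_bookD(5,6)[OF bk] by auto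

lemma pages_disjoint: "xs \<in> P \<Longrightarrow> ys \<in> P \<Longrightarrow> xs \<noteq> ys \<Longrightarrow> set xs \<inter> set ys = {}"
  by (rule is_bookD(7)[OF bk])

lemma hub_notin: "xs \<in> P \<Longrightarrow> u \<notin> set xs" "xs \<in> P \<Longrightarrow> v \<notin> set xs" "u \<noteq> v" "xs \<in> P \<Longrightarrow> distinct xs"
proof -
  obtain ys where "ys \<in> P" using third_page is_bookD(3)[OF bk] by metis
  then show "u \<noteq> v" using page(1)[of ys] by (auto simp: is_path_def)
qed (use page(1) in \<open>auto simp: is_path_def\<close>)

text \<open>From the hub, \<open>y\<close> is reached along \<open>B\<close> on its own page, or
  through another page to \<open>v\<close> and back along \<open>D\<close>. All pages being equally
  long, the second route is longer by at least two.\<close>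

lemma unique_length_hub:
  assumes len: "\<And>zs. is_path A u zs y \<Longrightarrow> length zs = n"
    and "ys \<in> P" "y \<in> set ys"
  shows False
proof -
  obtain B D where ys: "ys = B @ y # D" using \<open>y \<in> set ys\<close> by (meson split_list)
  obtain zs where zs: "zs \<in> P" "zs \<noteq> ys" using third_page is_bookD(3)[OF bk] by metis
  have 1: "is_path A u B y" "is_path A y D v"
    using page(1)[OF \<open>ys \<in> P\<close>] is_path_appendD unfolding ys by fast+
  have "is_path A v (rev D) y" using 1(2) is_path_rev by fast
  from is_path_append[OF page(1)[OF zs(1)] this] have "is_path A u (zs @ v # rev D) y"
    using pages_disjoint[OF zs(1) \<open>ys \<in> P\<close> zs(2)]
      hub_notin(1,2)[OF \<open>ys \<in> P\<close>] hub_notin(3) ys by auto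
  from len[OF this] len[OF 1(1)] page(2)[OF zs(1)] page(2)[OF \<open>ys \<in> P\<close>] ys
  show False by auto
qed

text \<open>The segment \<open>C\<close> is shorter than a page, while the way round through
  \<open>u\<close>, another page and \<open>v\<close> contains a whole page.\<close>

lemma unique_length_same_page:
  assumes len: "\<And>zs. is_path A x zs y \<Longrightarrow> length zs = n"
    and "ys \<in> P" "ys = B @ x # C @ y # D"
  shows False
proof -
  obtain zs where zs: "zs \<in> P" "zs \<noteq> ys" using third_page is_bookD(3)[OF bk] by metis
  have 1: "is_path A u B x" "is_path A x (C @ y # D) v"
    using page(1)[OF \<open>ys \<in> P\<close>] is_path_appendD unfolding assms(3) by fast+
  have 2: "is_path A x C y" "is_path A y D v" using 1(2) is_path_appendD by fast+
  have 3: "is_path A x (rev B) u" "is_path A v (rev D) y" using 1(1) 2(2) is_path_rev by fast+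
  note nt = hub_notin(1,2)[OF \<open>ys \<in> P\<close>] hub_notin(1,2)[OF zs(1)] hub_notin(3)
    pages_disjoint[OF zs(1) \<open>ys \<in> P\<close> zs(2)]
  have dist: "distinct ys" using hub_notin(4)[OF \<open>ys \<in> P\<close>] .
  have "is_path A u (zs @ v # rev D) y"
    using is_path_append[OF page(1)[OF zs(1)] 3(2)] nt assms(3) by auto
  from is_path_append[OF 3(1) this] have "is_path A x (rev B @ u # zs @ v # rev D) y"
    using nt assms(3) dist by auto
  from len[OF this] len[OF 2(1)] page(2)[OF zs(1)] page(2)[OF \<open>ys \<in> P\<close>] assms(3)
  show False by auto
qed

text \<open>Both routes first go from \<open>x\<close> to \<open>u\<close>. What remains is the
  comparison for a hub and an interior vertex: directly along \<open>D\<close>, or through a third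
  page to \<open>v\<close> and back along \<open>F\<close>. The page \<open>ws\<close> differs from
  both others, so the second route does not meet itself.\<close>

lemma unique_length_two_pages:
  assumes len: "\<And>zs. is_path A x zs y \<Longrightarrow> length zs = n"
    and "ys \<in> P" "zs \<in> P" "ys \<noteq> zs" "x \<in> set ys" "y \<in> set zs"
  shows False
proof -
  obtain B C where ys: "ys = B @ x # C" using \<open>x \<in> set ys\<close> by (meson split_list)
  obtain D F where zs: "zs = D @ y # F" using \<open>y \<in> set zs\<close> by (meson split_list)
  obtain ws where ws: "ws \<in> P" "ws \<noteq> ys" "ws \<noteq> zs" using third_page is_bookD(3)[OF bk] by metis
  have 1: "is_path A u B x" "is_path A x C v"
    using page(1)[OF \<open>ys \<in> P\<close>] is_path_appendD unfolding ys by fast+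
  have 2: "is_path A u D y" "is_path A y F v"
    using page(1)[OF \<open>zs \<in> P\<close>] is_path_appendD unfolding zs by fast+
  have 3: "is_path A x (rev B) u" "is_path A v (rev F) y" using 1(1) 2(2) is_path_rev by fast+
  note nt = hub_notin(1,2)[OF \<open>ys \<in> P\<close>] hub_notin(1,2)[OF \<open>zs \<in> P\<close>] hub_notin(1,2)[OF ws(1)]
    hub_notin(3) pages_disjoint[OF ws(1) \<open>ys \<in> P\<close> ws(2)] pages_disjoint[OF ws(1) \<open>zs \<in> P\<close> ws(3)]
    pages_disjoint[OF \<open>ys \<in> P\<close> \<open>zs \<in> P\<close> \<open>ys \<noteq> zs\<close>]
  have "is_path A x (rev B @ u # D) y"
    using is_path_append[OF 3(1) 2(1)] nt ys zs by auto
  moreover have "is_path A u (ws @ v # rev F) y"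
    using is_path_append[OF page(1)[OF ws(1)] 3(2)] nt zs by auto
  from is_path_append[OF 3(1) this] have "is_path A x (rev B @ u # ws @ v # rev F) y"
    using nt ys zs by auto
  ultimately have "length (rev B @ u # D) = length (rev B @ u # ws @ v # rev F)"
    using len by metis
  then show False using page(2)[OF ws(1)] page(2)[OF \<open>zs \<in> P\<close>] zs by auto
qed

end

lemma unique_length_book:
  assumes bk: "is_book m u v P A"
    and len: "\<And>zs. is_path A x zs y \<Longrightarrow> length zs = n"
    and "x \<in> Field A" "y \<in> Field A" "x \<noteq> y"
  shows "{x, y} = {u, v}"
proof (rule ccontr)
  assume neq: "{x, y} \<noteq> {u, v}"
  have len': "length zs = n" if "is_path A y zs x" for zs
    using len[of "rev zs"] that is_path_rev by fastforce
  \<comment> \<open>Stated for an arbitrary book so that it also serves the swapped one, in which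
    \<open>v\<close> takes the place of \<open>u\<close>.\<close>
  have hub: False if "is_book m w w' Q A" "z \<in> set zs" "zs \<in> Q" "w = x \<and> z = y \<or> w = y \<and> z = x"
    for w w' Q z zs
    using unique_length_hub[OF that(1) _ that(3,2)] len len' that(4) by blast
  have hub': False if "w \<in> {u, v}" "zs \<in> P" "z \<in> set zs" "w = x \<and> z = y \<or> w = y \<and> z = x" for w z zs
    using hub[OF bk that(3,2)] hub[OF is_book_swap[OF bk], of z "rev zs"] that by auto
  have Fx: "x \<in> {u, v} \<or> (\<exists>zs\<in>P. x \<in> set zs)" and Fy: "y \<in> {u, v} \<or> (\<exists>zs\<in>P. y \<in> set zs)"
    using Field_book[OF bk] assms(3,4) by auto
  have "x \<notin> {u, v}"
  proof
    assume "x \<in> {u, v}"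
    moreover from this have "y \<notin> {u, v}" using neq \<open>x \<noteq> y\<close> by auto
    ultimately show False using hub' Fy by blast
  qed
  moreover have "y \<notin> {u, v}"
  proof
    assume "y \<in> {u, v}"
    moreover from this have "x \<notin> {u, v}" using neq \<open>x \<noteq> y\<close> by auto
    ultimately show False using hub' Fx by blast
  qed
  ultimately obtain ys zs where "ys \<in> P" "x \<in> set ys" "zs \<in> P" "y \<in> set zs"
    using Fx Fy by auto
  then have "zs = ys" using unique_length_two_pages[OF bk len] by blast
  obtain B C where ys: "ys = B @ x # C" using \<open>x \<in> set ys\<close> by (meson split_list)
  then consider "y \<in> set B" | "y \<in> set C" using \<open>y \<in> set zs\<close> \<open>zs = ys\<close> \<open>x \<noteq> y\<close> by auto
  then show False
  proof cases
    case 1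
    then obtain D F where "B = D @ y # F" by (meson split_list)
    then have "ys = D @ y # F @ x # C" using ys by simp
    from unique_length_same_page[OF bk len' \<open>ys \<in> P\<close> this] show False .
  next
    case 2
    then obtain D F where "C = D @ y # F" by (meson split_list)
    then have "ys = B @ x # D @ y # F" using ys by simp
    from unique_length_same_page[OF bk len \<open>ys \<in> P\<close> this] show False .
  qed
qed

section \<open>Arcs of a cycle and ears\<close>

lemma cycle_split:
  assumes "is_cycle E c" "x \<in> set c" "y \<in> set c" "x \<noteq> y"
  obtains ys zs where "is_path (cedges c) x ys y" "is_path (cedges c) x zs y" "set ys \<inter> set zs = {}"
    "cedges c = edges (x # ys @ [y]) \<union> edges (x # zs @ [y])" "length ys + length zs + 2 = length c"
proof -
  obtain p s where c: "c = p @ x # s" using \<open>x \<in> set c\<close> by (meson split_list)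
  then have "y \<in> set (s @ p)" using assms by auto
  then obtain B D where sp: "s @ p = B @ y # D" by (meson split_list)
  have "cedges c = cedges (x # s @ p)" using cedges_rotate[of p "x # s"] c by simp
  also have "\<dots> = cedges (x # B @ y # D)" using sp by simp
  also have "\<dots> = edges (x # B @ [y]) \<union> edges (y # D @ [x])"
    using edges_append[of "x # B" y "D @ [x]"] by simp
  also have "edges (y # D @ [x]) = edges (x # rev D @ [y])"
    using edges_rev[of "y # D @ [x]"] by simp
  finally have eq: "cedges c = edges (x # B @ [y]) \<union> edges (x # rev D @ [y])" .
  have "distinct (x # s @ p)" using assms(1) c by (auto simp: is_cycle_def)
  then have dist: "distinct (x # B @ y # D)" using sp by simp
  have "length c = length (x # s @ p)" using c by simp
  also have "\<dots> = length (x # B @ y # D)" unfolding sp by simp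
  finally have "length B + length (rev D) + 2 = length c" by simp
  moreover have "is_path (cedges c) x B y" "is_path (cedges c) x (rev D) y"
    using dist eq by (auto simp: is_path_def)
  moreover have "set B \<inter> set (rev D) = {}" using dist by auto
  ultimately show thesis using that eq by blast
qed

text \<open>Cut the cycle open at \<open>a\<close>, one end of a shared arc, and extend an arc
  outside \<open>A\<close> in both directions until \<open>Field A\<close> is met. The other end
  \<open>b\<close> is a second vertex of \<open>Field A\<close> on the cycle and keeps the ends of
  the ear distinct; this is why a shared arc is required and not merely a shared vertex.\<close>

lemma exists_ear:
  assumes "sym A" "is_cycle E c" "cedges c \<inter> A \<noteq> {}" "\<not> cedges c \<subseteq> A"
  obtains x qs y where "is_path (cedges c) x qs y" "x \<in> Field A" "y \<in> Field A"
    "set qs \<inter> Field A = {}" "\<not> edges (x # qs @ [y]) \<subseteq> A"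
proof -
  obtain a b where ab: "(a, b) \<in> cedges c" "(a, b) \<in> A" using assms(3) by auto
  then have F: "a \<in> Field A" "b \<in> Field A" by (auto simp: Field_def)
  have ac: "a \<in> set c" "b \<in> set c"
    using ab Field_cedges[OF assms(2)] by (auto simp: Field_def)
  obtain p s where c: "c = p @ a # s" using ac(1) by (meson split_list)
  define W where "W = s @ p"
  have ce: "cedges c = edges (a # W @ [a])" using cedges_rotate[of p "a # s"] c W_def by simp
  have dW: "distinct (a # W)" using assms(2) c unfolding is_cycle_def W_def by auto
  have "set c = set (a # W)" using c W_def by auto
  have "a \<noteq> b"
  proof
    assume "a = b"
    then obtain p s where *: "a # W @ [a] = p @ a # a # s" using ab(1) edges_split[of a b] ce by metis
    have "W \<noteq> []" using c W_def assms(2) by (auto simp: is_cycle_def)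
    show False
    proof (cases p)
      case Nil
      then show False using * \<open>W \<noteq> []\<close> dW by (cases W) auto
    next
      case (Cons q p')
      then have eq: "W @ [a] = p' @ a # a # s" using * by (metis append_Cons list.inject)
      show False
      proof (cases s rule: rev_cases)
        case Nil
        then have "W = p' @ [a]" using eq by simp
        then show False using dW by simp
      next
        case (snoc s' z)
        then have "W = p' @ a # a # s'" using eq by simp
        then show False using dW by simp
      qed
    qed
  qed
  then have bW: "b \<in> set W" using ac \<open>set c = set (a # W)\<close> by auto
  obtain i' j' where ij': "(i', j') \<in> cedges c" "(i', j') \<notin> A" using assms(4) by auto
  \<comment> \<open>\<open>edges_split\<close> may return the arc reversed; by symmetry of
    \<open>A\<close> the reversed arc is outside \<open>A\<close> too.\<close>
  have "\<exists>i j pre post. a # W @ [a] = pre @ i # j # post \<and> (i, j) \<notin> A"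
    using edges_split[OF ij'(1)[unfolded ce]] ij'(2) assms(1) by (metis symD)
  then obtain i j pre post where L: "a # W @ [a] = pre @ i # j # post" and ij: "(i, j) \<notin> A" by blast
  have "a \<in> set (pre @ [i])" using L by (cases pre) auto
  then have "\<exists>x\<in>set (pre @ [i]). x \<in> Field A" using F by auto
  then obtain pre' x Q1 where x: "pre @ [i] = pre' @ x # Q1" "x \<in> Field A" "\<forall>q\<in>set Q1. q \<notin> Field A"
    using split_list_last_prop[of "pre @ [i]" "\<lambda>x. x \<in> Field A"] by blast
  have "last (j # post) = a" using arg_cong[OF L, of last] by simp
  then have "a \<in> set (j # post)" using last_in_set[of "j # post"] by (metis list.discI)
  then have "\<exists>x\<in>set (j # post). x \<in> Field A" using F by auto
  then obtain Q2 y post' where y: "j # post = Q2 @ y # post'" "y \<in> Field A" "\<forall>q\<in>set Q2. q \<notin> Field A"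
    using split_list_first_prop[of "j # post" "\<lambda>x. x \<in> Field A"] by blast
  have L': "a # W @ [a] = pre' @ (x # (Q1 @ Q2) @ [y]) @ post'"
    using L x(1) y(1) by (metis append.assoc append_Cons append_Nil)
  \<comment> \<open>Otherwise the ear would be the whole closed walk and \<open>W\<close> would
    avoid \<open>Field A\<close>, contrary to \<open>b\<close>. So at least one of the two
    occurrences of \<open>a\<close> is cut off, and the segment that is left has distinct
    vertices.\<close>
  have ne: "pre' \<noteq> [] \<or> post' \<noteq> []"
  proof (rule ccontr)
    assume "\<not> (pre' \<noteq> [] \<or> post' \<noteq> [])"
    then have "W = Q1 @ Q2" using L' by simp
    then show False using bW F x(3) y(3) by auto
  qed
  have "distinct (x # (Q1 @ Q2) @ [y])"
  proof (cases "post' = []")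
    case True
    then obtain q p' where "pre' = q # p'" using ne by (meson neq_Nil_conv)
    then have "W @ [a] = p' @ x # (Q1 @ Q2) @ [y]" using L' True
      by (metis append.right_neutral append_Cons list.inject)
    moreover have "distinct (W @ [a])" using dW by simp
    ultimately show ?thesis by (metis distinct_append)
  next
    case False
    then obtain s' z where "post' = s' @ [z]" by (metis rev_exhaust)
    then have "a # W = pre' @ (x # (Q1 @ Q2) @ [y]) @ s'" using L'
      by (metis append.assoc append_Cons butlast_snoc)
    then show ?thesis using dW by (metis distinct_append)
  qed
  moreover have "edges (x # (Q1 @ Q2) @ [y]) \<subseteq> cedges c"
    unfolding ce L' by (rule edges_sublist)
  ultimately have "is_path (cedges c) x (Q1 @ Q2) y" by (auto simp: is_path_def)
  moreover have "(i, j) \<in> edges (x # (Q1 @ Q2) @ [y])"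
  proof -
    have "\<exists>l. x # Q1 = l @ [i]" using x(1) by (metis append_butlast_last_id last_appendR last_snoc list.discI)
    moreover have "\<exists>l. Q2 @ [y] = j # l" using y(1) by (cases Q2) auto
    ultimately obtain l l' where "x # Q1 = l @ [i]" "Q2 @ [y] = j # l'" by blast
    then have "x # (Q1 @ Q2) @ [y] = l @ i # j # l'" by (metis append.assoc append_Cons append_Nil)
    then show ?thesis using edges_append[of l i "j # l'"] by auto
  qed
  ultimately show thesis using that[of x "Q1 @ Q2" y] x y ij by auto
qed

lemma card_insert_page:
  assumes "is_book m u v P A" "set qs \<inter> Field A = {}" "qs \<noteq> []"
  shows "card (insert qs P) = Suc (card P)"
proof -
  have "qs \<notin> P" using assms Field_book[OF assms(1)] by (cases qs) auto
  then show ?thesis using is_bookD(2)[OF assms(1)] by simp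
qed

section \<open>Adding ears and cycles to a cycle or a book\<close>

locale equal_cycles =
  fixes E :: "('a \<times> 'a) set" and r :: nat
  assumes cycle_length: "is_cycle E c \<Longrightarrow> length c = r"
begin

definition cycle_or_book :: "('a \<times> 'a) set \<Rightarrow> bool" where
  "cycle_or_book A \<longleftrightarrow> A \<subseteq> E \<and>
     ((\<exists>c. is_cycle E c \<and> A = cedges c) \<or> (\<exists>m u v P. r = 2 * m \<and> is_book m u v P A))"

lemma cycle_or_book_sym:
  assumes "cycle_or_book A"
  shows "sym A"
proof (cases "\<exists>c. A = cedges c")
  case True
  then show ?thesis using sym_edges by metis
next
  case False
  then obtain m u v P where "is_book m u v P A"
    using assms by (auto simp: cycle_or_book_def)
  from is_bookD(4)[OF this] show ?thesis by (metis sym_UNION sym_edges)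
qed

text \<open>Closing an ear with any path of \<open>A\<close> between its ends yields a cycle, so all these paths have
  the same length.\<close>

lemma ear_length:
  assumes "A \<subseteq> E" "is_path E x qs y" "set qs \<inter> Field A = {}" "qs \<noteq> [] \<or> (x, y) \<notin> A"
    and "is_path A x zs y"
  shows "length zs + length qs + 2 = r"
proof -
  have "zs \<noteq> [] \<or> qs \<noteq> []" using assms(4,5) by (auto simp: is_path_def)
  moreover have "set zs \<inter> set qs = {}" using is_path_Field[OF assms(5)] assms(3) by auto
  ultimately have "is_cycle E (x # zs @ y # rev qs)"
    using is_cycle_of_paths[OF is_path_mono[OF assms(5,1)] assms(2)] by auto
  from cycle_length[OF this] show ?thesis by simp
qed

lemma cycle_or_book_add_ear:
  assumes A: "cycle_or_book A" and path: "is_path E x qs y" and xy: "x \<in> Field A" "y \<in> Field A"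
    and disj: "set qs \<inter> Field A = {}" and new: "qs \<noteq> [] \<or> (x, y) \<notin> A"
  shows "cycle_or_book (A \<union> edges (x # qs @ [y]))"
proof -
  have AE: "A \<subseteq> E" using A by (simp add: cycle_or_book_def)
  note len = ear_length[OF AE path disj new]
  have neq: "x \<noteq> y" using path by (auto simp: is_path_def)
  have sub: "A \<union> edges (x # qs @ [y]) \<subseteq> E" using AE path by (auto simp: is_path_def)
  consider c where "is_cycle E c" "A = cedges c" | m u v P where "r = 2 * m" "is_book m u v P A"
    using A by (auto simp: cycle_or_book_def)
  then show ?thesis
  proof cases
    case 1
    obtain ys zs where yz: "is_path A x ys y" "is_path A x zs y" "set ys \<inter> set zs = {}"
      "A = edges (x # ys @ [y]) \<union> edges (x # zs @ [y])" "length ys + length zs + 2 = length c"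
      using cycle_split[OF 1(1), of x y] xy neq Field_cedges[OF 1(1)] 1(2) by metis
    \<comment> \<open>The three paths pairwise form cycles, so any two of their lengths add up to
      \<open>r\<close>. Hence each has length \<open>m\<close> with \<open>r = 2 * m\<close>, and
      \<open>2 \<le> m\<close> because a cycle has at least three vertices.\<close>
    define m where "m = Suc (length qs)"
    have eqs: "length ys = length qs" "length zs = length qs" "r = 2 * m" "2 \<le> m"
      using len[OF yz(1)] len[OF yz(2)] yz(5) cycle_length[OF 1(1)] 1(1)
      by (auto simp: m_def is_cycle_def)
    have ne: "qs \<noteq> []" "ys \<noteq> []" "zs \<noteq> []" using eqs m_def by auto
    have dq: "set qs \<inter> set ys = {}" "set qs \<inter> set zs = {}"
      using is_path_Field[OF yz(1)] is_path_Field[OF yz(2)] disj by auto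
    have "qs \<noteq> ys" "qs \<noteq> zs" "ys \<noteq> zs" using dq yz(3) ne by auto
    then have "card {qs, ys, zs} = 3" by simp
    moreover have "is_path (A \<union> edges (x # qs @ [y])) x ws y" if "ws \<in> {qs, ys, zs}" for ws
      using that yz(1,2) is_path_mono[of A] path by (auto simp: is_path_def)
    moreover have "A \<union> edges (x # qs @ [y]) = (\<Union>zs\<in>{qs, ys, zs}. edges (x # zs @ [y]))"
      using yz(4) by auto
    moreover have "set ws \<inter> set ws' = {}"
      if "ws \<in> {qs, ys, zs}" "ws' \<in> {qs, ys, zs}" "ws \<noteq> ws'" for ws ws'
      using that dq yz(3) by auto
    ultimately have "is_book m x y {qs, ys, zs} (A \<union> edges (x # qs @ [y]))"
      using eqs unfolding is_book_def by (intro conjI ballI impI) (auto simp: m_def)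
    then show ?thesis using eqs(3) sub unfolding cycle_or_book_def by blast
  next
    case 2
    have "length zs = r - 2 - length qs" if "is_path A x zs y" for zs
      using len[OF that] by simp
    then have "{x, y} = {u, v}" using unique_length_book[OF 2(2) _ xy neq] by blast
    \<comment> \<open>The ear may meet the hubs in either order; if necessary the book is swapped so
      that \<open>x\<close> is its first hub.\<close>
    then obtain Q where Q: "is_book m x y Q A"
      using 2(2) is_book_swap by (metis doubleton_eq_iff)
    then obtain ys where "ys \<in> Q" using third_page is_bookD(3) by metis
    have lq: "Suc (length qs) = m"
      using len[OF page(1)[OF Q \<open>ys \<in> Q\<close>]] page(2)[OF Q \<open>ys \<in> Q\<close>] 2(1) by simp
    then have "qs \<noteq> []" using is_bookD(1)[OF Q] by auto
    note card = card_insert_page[OF Q disj this]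
    have *: "set qs \<inter> set zs = {}" if "zs \<in> Q" for zs
      using disj Field_book[OF Q] that by auto
    have "is_path (A \<union> edges (x # qs @ [y])) x zs y" if "zs \<in> insert qs Q" for zs
      using that page(1)[OF Q] is_path_mono[of A] path by (auto simp: is_path_def)
    moreover have "set ys \<inter> set zs = {}"
      if "ys \<in> insert qs Q" "zs \<in> insert qs Q" "ys \<noteq> zs" for ys zs
      using that * is_bookD(7)[OF Q, of ys zs] by auto
    moreover have "A \<union> edges (x # qs @ [y]) = (\<Union>zs\<in>insert qs Q. edges (x # zs @ [y]))"
      using is_bookD(4)[OF Q] by auto
    ultimately have "is_book m x y (insert qs Q) (A \<union> edges (x # qs @ [y]))"
      using is_bookD(1-3,5)[OF Q] card lq unfolding is_book_def by (intro conjI ballI impI) auto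
    then show ?thesis using 2(1) sub unfolding cycle_or_book_def by blast
  qed
qed

text \<open>Induction on the number of arcs of \<open>c\<close> missing from \<open>A\<close>. Each
  ear supplies at least one of them and consists of arcs of \<open>c\<close>, so the union with
  \<open>cedges c\<close> does not change.\<close>

lemma cycle_or_book_add_cycle:
  assumes "cycle_or_book A" "is_cycle E c" "cedges c \<inter> A \<noteq> {}"
  shows "cycle_or_book (A \<union> cedges c)"
  using assms
proof (induction "card (cedges c - A)" arbitrary: A rule: less_induct)
  case less
  show ?case
  proof (cases "cedges c \<subseteq> A")
    case True
    then show ?thesis using less.prems by (simp add: Un_absorb2)
  next
    case False
    have "sym A" using less.prems cycle_or_book_sym by blast
    obtain x qs y where ear: "is_path (cedges c) x qs y" "x \<in> Field A" "y \<in> Field A"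
      "set qs \<inter> Field A = {}" "\<not> edges (x # qs @ [y]) \<subseteq> A"
      using exists_ear[OF \<open>sym A\<close> less.prems(2,3) False] .
    let ?A = "A \<union> edges (x # qs @ [y])"
    have sub: "edges (x # qs @ [y]) \<subseteq> cedges c" using ear(1) by (simp add: is_path_def)
    have "qs \<noteq> [] \<or> (x, y) \<notin> A" using ear(5) \<open>sym A\<close> by (auto dest: symD)
    then have "cycle_or_book ?A"
      using cycle_or_book_add_ear[OF less.prems(1) _ ear(2-4)] is_path_mono[OF ear(1)] less.prems(2)
      by (auto simp: is_cycle_def)
    moreover have "card (cedges c - ?A) < card (cedges c - A)"
      using ear(5) sub by (intro psubset_card_mono) auto
    moreover have "cedges c \<inter> ?A \<noteq> {}" using less.prems(3) by auto
    ultimately have "cycle_or_book (?A \<union> cedges c)" using less.hyps less.prems(2) by blast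
    moreover have "?A \<union> cedges c = A \<union> cedges c" using sub by auto
    ultimately show ?thesis by simp
  qed
qed

end

section \<open>Closed walks and isomorphisms\<close>

lemma pcas_edges:
  assumes "pcas u p v"
  shows "set p \<union> (set p)\<inverse> = edges (map fst p @ [v])" "map fst p @ [v] = u # map snd p"
    "pawalk_verts u p = u # map snd p"
proof -
  have "set p \<union> (set p)\<inverse> = edges (map fst p @ [v]) \<and> map fst p @ [v] = u # map snd p \<and>
    pawalk_verts u p = u # map snd p"
    using assms
  proof (induction p arbitrary: u)
    case (Cons e es)
    have hyp: "set es \<union> (set es)\<inverse> = edges (map fst es @ [v])"
      "map fst es @ [v] = snd e # map snd es" "pawalk_verts (snd e) es = snd e # map snd es"
      using Cons by auto
    show ?case using hyp Cons.prems by (cases e) auto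
  qed simp
  then show "set p \<union> (set p)\<inverse> = edges (map fst p @ [v])" "map fst p @ [v] = u # map snd p"
    "pawalk_verts u p = u # map snd p" by auto
qed

lemma pcas_zip: "pcas x (zip (x # xs) (xs @ [y])) y"
  by (induction xs arbitrary: x) auto

lemma graph_cycle_is_cycle:
  assumes "pair_graph G" "graph_cycle G p"
  shows "is_cycle (parcs G) (map fst p)" "set p \<union> (set p)\<inverse> = cedges (map fst p)"
proof -
  interpret pair_graph G by fact
  obtain u where u: "awalk u p u" "distinct (tl (pawalk_verts u p))" "p \<noteq> []" "3 \<le> length p"
    using assms(2) by (auto simp: graph_cycle_def cycle_def)
  have cas: "pcas u p u" and sub: "set p \<subseteq> parcs G" using u(1) by (auto simp: awalk_def)
  note e = pcas_edges[OF cas]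
  have hd: "hd (map fst p) = u" using e(2) u(3) by (cases p) auto
  then show eq: "set p \<union> (set p)\<inverse> = cedges (map fst p)" using e(1) by simp
  \<comment> \<open>The digraph notion of cycle asks for distinct heads, \<open>is_cycle\<close> for
    distinct tails; in a closed walk both form the same multiset.\<close>
  have "mset (map fst p @ [u]) = mset (u # map snd p)" using e(2) by simp
  then have "mset (map fst p) = mset (map snd p)" by simp
  moreover have "distinct (map snd p)" using u(2) e(3) by simp
  ultimately have "distinct (map fst p)" using mset_eq_imp_distinct_iff by blast
  moreover have "(set p)\<inverse> \<subseteq> parcs G"
    using sub pair_sym_arcs by (auto simp: symmetric_def dest: symD)
  ultimately show "is_cycle (parcs G) (map fst p)"
    using u(4) sub eq by (auto simp: is_cycle_def)
qed

lemma is_cycle_graph_cycle: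
  assumes "pair_graph G" "is_cycle (parcs G) c"
  obtains p where "graph_cycle G p" "map fst p = c"
proof -
  interpret pair_graph G by fact
  obtain x xs where c: "c = x # xs" using assms(2) by (cases c) (auto simp: is_cycle_def)
  define p where "p = zip (x # xs) (xs @ [x])"
  have cas: "pcas x p x" unfolding p_def by (rule pcas_zip)
  have fst: "map fst p = c" and snd: "map snd p = xs @ [x]" by (simp_all add: p_def c)
  note e = pcas_edges[OF cas]
  have sub: "set p \<subseteq> parcs G" using e(1) fst c assms(2) by (auto simp: is_cycle_def)
  have "p \<noteq> []" by (auto simp: p_def)
  then obtain a where "a \<in> set p" "fst a = x" using fst c by (cases p) auto
  then have "x \<in> pverts G" using sub arc_fst_in_verts by blast
  then have "awalk x p x" using cas sub by (simp add: awalk_def)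
  moreover have "distinct (tl (pawalk_verts x p))"
    using e(3) snd assms(2) c by (auto simp: is_cycle_def)
  moreover have "length p = length c" using fst by (metis length_map)
  ultimately have "graph_cycle G p"
    using \<open>p \<noteq> []\<close> assms(2) unfolding graph_cycle_def cycle_def is_cycle_def by auto
  then show thesis using that fst by blast
qed

lemma cycle_subgraphs_eq:
  assumes "pair_graph G"
  shows "cycle_subgraphs G = {\<lparr>pverts = set c, parcs = cedges c\<rparr> | c. is_cycle (parcs G) c}" (is "_ = ?R")
proof
  show "cycle_subgraphs G \<subseteq> ?R"
  proof
    fix C assume "C \<in> cycle_subgraphs G"
    then obtain p where p: "graph_cycle G p" "C = \<lparr>pverts = fst ` set p, parcs = set p \<union> (set p)\<inverse>\<rparr>"
      unfolding cycle_subgraphs_def by blast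
    then have "C = \<lparr>pverts = set (map fst p), parcs = cedges (map fst p)\<rparr>"
      using graph_cycle_is_cycle(2)[OF assms] by simp
    then show "C \<in> ?R" using graph_cycle_is_cycle(1)[OF assms p(1)] by blast
  qed
  show "?R \<subseteq> cycle_subgraphs G"
  proof
    fix C assume "C \<in> ?R"
    then obtain c where c: "C = \<lparr>pverts = set c, parcs = cedges c\<rparr>" "is_cycle (parcs G) c" by auto
    obtain p where p: "graph_cycle G p" "map fst p = c" using is_cycle_graph_cycle[OF assms c(2)] .
    have "C = \<lparr>pverts = fst ` set p, parcs = set p \<union> (set p)\<inverse>\<rparr>"
      using graph_cycle_is_cycle(2)[OF assms p(1)] p(2) c(1) by (metis list.set_map)
    then show "C \<in> cycle_subgraphs G" using p(1) by (auto simp: cycle_subgraphs_def)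
  qed
qed

lemma cycle_lengths_eq:
  assumes "pair_graph G"
  shows "cycle_lengths G = length ` {c. is_cycle (parcs G) c}"
proof (rule set_eqI)
  fix n
  have "(\<exists>p. n = length p \<and> graph_cycle G p) \<longleftrightarrow> (\<exists>c. n = length c \<and> is_cycle (parcs G) c)"
    using graph_cycle_is_cycle(1)[OF assms] is_cycle_graph_cycle[OF assms] by (metis length_map)
  then show "n \<in> cycle_lengths G \<longleftrightarrow> n \<in> length ` {c. is_cycle (parcs G) c}"
    unfolding cycle_lengths_def by blast
qed

lemma equal_cycles_girth_circum:
  assumes "pair_graph G" "r = girth G" "r = circum G"
  shows "equal_cycles (parcs G) r"
proof
  fix c assume c: "is_cycle (parcs G) c"
  interpret pair_graph G by fact
  \<comment> \<open>\<open>Min\<close> and \<open>Max\<close> bound the cycle lengths only once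
    these are known to form a finite set.\<close>
  have "length c' \<le> card (pverts G)" if "is_cycle (parcs G) c'" for c'
  proof -
    have "Field (parcs G) \<subseteq> pverts G"
      by (auto simp: Field_def dest: in_arcsD1 in_arcsD2)
    then have "set c' \<subseteq> pverts G"
      using Field_cedges[OF that] mono_Field[of "cedges c'" "parcs G"] that by (auto simp: is_cycle_def)
    then show ?thesis
      using that card_mono[OF pair_finite_verts, of "set c'"] distinct_card[of c']
      by (simp add: is_cycle_def)
  qed
  then have "finite (cycle_lengths G)"
    unfolding cycle_lengths_eq[OF assms(1)] by (intro finite_subset[OF _ finite_atMost]) auto
  moreover have "length c \<in> cycle_lengths G" using c cycle_lengths_eq[OF assms(1)] by auto
  ultimately show "length c = r"
    using assms(2,3) Min_le Max_ge unfolding girth_def circum_def by (metis le_antisym)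
qed

context equal_cycles
begin

text \<open>The indices stand for faces and \<open>B\<close> for the arcs of their bounding cycles.
  A maximal cycle or book within the union absorbs these cycles one after the other along any chain
  of adjacent faces. Maximality refers to subsets of the finite set \<open>E\<close>, so the faces
  need not be enumerated.\<close>

lemma cycle_or_book_connected_Union:
  assumes "finite E"
    and cyc: "\<And>F. (F\<^sub>0, F) \<in> adj\<^sup>* \<Longrightarrow> \<exists>c. is_cycle E c \<and> B F = cedges c"
    and adj: "\<And>F F'. (F, F') \<in> adj \<Longrightarrow> B F \<inter> B F' \<noteq> {}"
  shows "cycle_or_book (\<Union>F\<in>{F. (F\<^sub>0, F) \<in> adj\<^sup>*}. B F)" (is "cycle_or_book ?U")
proof -
  let ?X = "{X. cycle_or_book X \<and> B F\<^sub>0 \<subseteq> X \<and> X \<subseteq> ?U}"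
  have "?X \<subseteq> Pow E" by (auto simp: cycle_or_book_def)
  then have "finite ?X" using \<open>finite E\<close> by (meson finite_Pow_iff finite_subset)
  moreover have "B F\<^sub>0 \<in> ?X"
    using cyc[of F\<^sub>0] by (auto simp: cycle_or_book_def is_cycle_def)
  ultimately obtain X where X: "X \<in> ?X" and max: "\<forall>Y\<in>?X. X \<subseteq> Y \<longrightarrow> X = Y"
    using finite_has_maximal[of ?X] by (metis (no_types, lifting) empty_iff)
  have "B F \<subseteq> X" if "(F\<^sub>0, F) \<in> adj\<^sup>*" for F
    using that
  proof (induction rule: rtrancl_induct)
    case base
    then show ?case using X by simp
  next
    case (step F F')
    have F': "(F\<^sub>0, F') \<in> adj\<^sup>*" using step.hyps by simp
    obtain c where c: "is_cycle E c" "B F' = cedges c" using cyc[OF F'] by blast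
    have "cedges c \<inter> X \<noteq> {}" using adj[OF step.hyps(2)] step.IH c(2) by blast
    then have "cycle_or_book (X \<union> B F')" using cycle_or_book_add_cycle[of X c] X c by simp
    then have "X \<union> B F' \<in> ?X" using X F' by blast
    then have "X = X \<union> B F'" using max by (meson Un_upper1)
    then show ?case by blast
  qed
  then have "X = ?U" using X by blast
  then show ?thesis using X by simp
qed

end

section \<open>Isomorphisms with the model graphs\<close>

lemma digraph_isoI:
  assumes inj: "inj_on f (pverts K)" and sub: "parcs K \<subseteq> pverts K \<times> pverts K"
    and "pverts H = f ` pverts K" "parcs H = map_prod f f ` parcs K"
  shows "digraph_iso (with_proj H) (with_proj K)"
proof -
  \<comment> \<open>\<open>digraph_iso\<close> wants a map from \<open>H\<close> to
    \<open>K\<close>, but the maps constructed below start at the explicit vertices of the model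
    graph \<open>K\<close>; hence the inverse of \<open>f\<close>.\<close>
  let ?g = "the_inv_into (pverts K) f"
  let ?hom = "\<lparr>iso_verts = ?g, iso_arcs = map_prod ?g ?g, iso_head = snd, iso_tail = fst\<rparr>"
  have Hsub: "parcs H \<subseteq> pverts H \<times> pverts H" using assms by force
  have gf: "?g (f x) = x" if "x \<in> pverts K" for x using the_inv_into_f_f[OF inj that] .
  have injg: "inj_on ?g (pverts H)" using inj_on_the_inv_into[OF inj] assms(3) by simp
  have "inj_on (map_prod ?g ?g) (parcs H)"
    using map_prod_inj_on[OF injg injg] Hsub inj_on_subset by blast
  moreover have "wf_digraph (with_proj H)" using Hsub by unfold_locales auto
  ultimately have "pre_digraph.digraph_isomorphism (with_proj H) ?hom"
    using injg by (auto simp: pre_digraph.digraph_isomorphism_def)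
  moreover have "with_proj K = app_iso ?hom (with_proj H)"
  proof -
    have "pverts K = ?g ` pverts H" using gf assms(3) by (simp add: image_image)
    moreover have "map_prod ?g ?g (map_prod f f e) = e" if "e \<in> parcs K" for e
      using gf sub that by (cases e) auto
    then have "map_prod ?g ?g ` map_prod f f ` parcs K = parcs K" by (simp add: image_image)
    ultimately show ?thesis using assms(4) by (simp add: app_iso_def with_proj_def)
  qed
  ultimately show ?thesis unfolding digraph_iso_def by blast
qed

lemma map_prod_converse: "map_prod f f ` (A\<inverse>) = (map_prod f f ` A)\<inverse>"
  by (auto simp: image_iff)

lemma cedges_conv_nth:
  assumes "c \<noteq> []"
  shows "cedges c = (let A = {(c ! j, c ! (Suc j mod length c)) | j. j < length c} in A \<union> A\<inverse>)"
proof -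
  have "{((c @ [hd c]) ! i, (c @ [hd c]) ! Suc i) | i. Suc i < length (c @ [hd c])} =
        {(c ! j, c ! (Suc j mod length c)) | j. j < length c}"
  proof -
    have "((c @ [hd c]) ! i, (c @ [hd c]) ! Suc i) = (c ! i, c ! (Suc i mod length c))"
      if "i < length c" for i
    proof (cases "Suc i < length c")
      case False
      then have "Suc i = length c" using that by simp
      then show ?thesis using that assms by (simp add: nth_append hd_conv_nth)
    qed (simp add: nth_append)
    then show ?thesis by (intro Collect_cong ex_cong1) auto
  qed
  then show ?thesis unfolding edges_conv_nth[of "c @ [hd c]"] by (simp add: Let_def)
qed

lemma cycle_iso:
  assumes "is_cycle E c" "pverts H = Field (parcs H)" "parcs H = cedges c"
  shows "digraph_iso (with_proj H) (with_proj (cycle_graph (length c)))"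
proof (rule digraph_isoI[where f = "(!) c"])
  have c: "c \<noteq> []" "distinct c" using assms(1) by (auto simp: is_cycle_def)
  show "inj_on ((!) c) (pverts (cycle_graph (length c)))"
    using c inj_on_nth[of c] by (auto simp: cycle_graph_def Let_def)
  show "parcs (cycle_graph (length c)) \<subseteq> pverts (cycle_graph (length c)) \<times> pverts (cycle_graph (length c))"
    using c by (auto simp: cycle_graph_def Let_def)
  have "(!) c ` {..<length c} = set c"
    using nth_image[of "length c" c] by (simp add: lessThan_atLeast0)
  then show "pverts H = (!) c ` pverts (cycle_graph (length c))"
    using assms(2,3) Field_cedges[OF assms(1)] by (simp add: cycle_graph_def Let_def)
  let ?A = "{(j, Suc j mod length c) | j. j < length c}"
  have "map_prod ((!) c) ((!) c) ` ?A = {(c ! j, c ! (Suc j mod length c)) | j. j < length c}"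
    by (auto simp: image_Collect)
  then show "parcs H = map_prod ((!) c) ((!) c) ` parcs (cycle_graph (length c))"
    using assms(3) cedges_conv_nth[OF c(1)]
    by (simp add: cycle_graph_def Let_def image_Un map_prod_converse)
qed

lemma image_setcompr2: "h ` {g i j | i j. P i j} = {h (g i j) | i j. P i j}"
  by blast

lemma book_iso:
  assumes bk: "is_book m u v P (parcs H)" and "pverts H = Field (parcs H)"
  shows "digraph_iso (with_proj H) (with_proj (book_graph m (2 * m) (card P - 1)))"
proof -
  note m = is_bookD(1)[OF bk] and neq = hub_notin(3)[OF bk]
  obtain h where h: "bij_betw h {..<card P} P"
    using is_bookD(2)[OF bk] ex_bij_betw_nat_finite[of P] by (auto simp: atLeast0LessThan)
  obtain p where p: "card P = Suc p" "1 \<le> p" using is_bookD(3)[OF bk] by (cases "card P") auto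
  define q where "q i = u # h i @ [v]" for i
  \<comment> \<open>Page \<open>0\<close> is the common path, and page \<open>Suc i\<close>, run backwards, closes the \<open>i\<close>-th cycle.\<close>
  define f where "f = (\<lambda>(i, j). if j \<le> m then q 0 ! j else q (Suc i) ! (2 * m - j))"
  have hP: "h i \<in> P" if "i \<le> p" for i using h p that by (auto simp: bij_betw_def)
  have hneq: "set (h i) \<inter> set (h j) = {}" if "i \<le> p" "j \<le> p" "i \<noteq> j" for i j
    using h p that is_bookD(7)[OF bk hP hP] unfolding bij_betw_def inj_on_def
    by (metis lessThan_iff less_Suc_eq_le)
  have len: "length (q i) = Suc m" if "i \<le> p" for i
    using is_bookD(5)[OF bk hP[OF that]] by (simp add: q_def)
  have dist: "distinct (q i)" if "i \<le> p" for i
    using is_bookD(6)[OF bk hP[OF that]] by (simp add: q_def is_path_def)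
  have ends: "q i ! 0 = u" "q i ! m = v" if "i \<le> p" for i
    using is_bookD(5)[OF bk hP[OF that]] by (auto simp: q_def nth_append nth_Cons split: nat.split)
  have inner: "q i ! j \<in> set (h i)" if "i \<le> p" "0 < j" "j < m" for i j
    using is_bookD(5)[OF bk hP[OF that(1)]] that by (auto simp: q_def nth_append nth_Cons split: nat.split)
  \<comment> \<open>\<open>f\<close> is constant on glued vertices, so it can be evaluated on the
    pairs before gluing.\<close>
  have glue: "f (book_glue m x) = f x" for x by (auto simp: f_def book_glue_def split: prod.split)
  have f1: "f (i, j) = q 0 ! j" if "j \<le> m" for i j using that by (simp add: f_def)
  \<comment> \<open>The clauses of \<open>f\<close> agree where they meet: entry \<open>m\<close> of
    every page is \<open>v\<close>, and the index \<open>2 * m\<close>, which wraps to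
    \<open>0\<close>, gives \<open>u\<close>, the entry \<open>0\<close> of every page.\<close>
  have f2: "f (i, j) = q (Suc i) ! (2 * m - j)" if "m \<le> j" "i < p" for i j
    using that ends(2)[of 0] ends(2)[of "Suc i"] by (cases "j = m") (auto simp: f_def)
  have f3: "f (i, j mod (2 * m)) = q (Suc i) ! (2 * m - j)" if "m \<le> j" "j \<le> 2 * m" "i < p" for i j
    using that f2[of j i] f1[of 0 i] ends(1)[of 0] ends(1)[of "Suc i"] m by (cases "j = 2 * m") auto
  have K: "pverts (book_graph m (2 * m) p) = book_glue m ` ({..<p} \<times> {..<2 * m})"
    and KA: "parcs (book_graph m (2 * m) p) =
      {(book_glue m (i, j), book_glue m (i, Suc j mod (2 * m))) | i j. i < p \<and> j < 2 * m} \<union>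
      {(book_glue m (i, j), book_glue m (i, Suc j mod (2 * m))) | i j. i < p \<and> j < 2 * m}\<inverse>"
    by (simp_all add: book_graph_def Let_def)
  have arcsP: "parcs H = (\<Union>i\<le>p. edges (q i))"
  proof -
    have "P = h ` {..p}" using h p by (simp add: bij_betw_def lessThan_Suc_atMost)
    then show ?thesis using is_bookD(4)[OF bk] by (simp add: q_def)
  qed
  \<comment> \<open>The first half of each glued cycle follows page \<open>0\<close>, the second
    half follows page \<open>Suc i\<close> backwards; adding the converse then yields all arcs of
    all pages.\<close>
  have "{(f (i, j), f (i, Suc j mod (2 * m))) | i j. i < p \<and> j < 2 * m} =
     {(q 0 ! j, q 0 ! Suc j) | j. j < m} \<union>
     {(q (Suc i) ! Suc j, q (Suc i) ! j) | i j. i < p \<and> j < m}" (is "?L = ?R")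
  proof
    show "?L \<subseteq> ?R"
    proof clarify
      fix i j assume ij: "i < p" "j < 2 * m"
        and no: "\<not> (\<exists>i' j'. (f (i, j), f (i, Suc j mod (2 * m))) = (q (Suc i') ! Suc j', q (Suc i') ! j') \<and> i' < p \<and> j' < m)"
      have "j < m"
      proof (rule ccontr)
        assume "\<not> j < m"
        then have "f (i, j) = q (Suc i) ! Suc (2 * m - Suc j)" "f (i, Suc j mod (2 * m)) = q (Suc i) ! (2 * m - Suc j)"
          using f2[of j i] f3[of "Suc j" i] ij by (auto simp: Suc_diff_Suc)
        moreover have "2 * m - Suc j < m" using \<open>\<not> j < m\<close> ij by simp
        ultimately show False using no ij by blast
      qed
      then show "\<exists>j'. (f (i, j), f (i, Suc j mod (2 * m))) = (q 0 ! j', q 0 ! Suc j') \<and> j' < m"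
        using f1 m by auto
    qed
    show "?R \<subseteq> ?L"
    proof clarify
      fix a b assume "(a, b) \<in> ?R"
      then consider j where "a = q 0 ! j" "b = q 0 ! Suc j" "j < m"
        | i j where "a = q (Suc i) ! Suc j" "b = q (Suc i) ! j" "i < p" "j < m" by blast
      then show "\<exists>i j. (a, b) = (f (i, j), f (i, Suc j mod (2 * m))) \<and> i < p \<and> j < 2 * m"
      proof cases
        case 1
        then have "(a, b) = (f (0, j), f (0, Suc j mod (2 * m))) \<and> 0 < p \<and> j < 2 * m" using f1 m p by auto
        then show ?thesis by blast
      next
        case 2
        then have "(a, b) = (f (i, 2 * m - Suc j), f (i, Suc (2 * m - Suc j) mod (2 * m))) \<and> i < p \<and> 2 * m - Suc j < 2 * m"
          using f2[of "2 * m - Suc j" i] f3[of "Suc (2 * m - Suc j)" i] by auto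
        then show ?thesis by blast
      qed
    qed
  qed
  moreover have "parcs H = ?R \<union> ?R\<inverse>"
  proof -
    have eq: "edges (q i) = {(q i ! j, q i ! Suc j) | j. j < m} \<union> {(q i ! Suc j, q i ! j) | j. j < m}" if "i \<le> p" for i
      using len[OF that] unfolding edges_conv_nth[of "q i"] by auto
    have "(\<Union>i\<le>p. edges (q i)) = edges (q 0) \<union> (\<Union>i<p. edges (q (Suc i)))"
      using lessThan_Suc_eq_insert_0[of p] by (simp add: lessThan_Suc_atMost[symmetric])
    also have "\<dots> = {(q 0 ! j, q 0 ! Suc j) | j. j < m} \<union> {(q 0 ! Suc j, q 0 ! j) | j. j < m} \<union>
      (\<Union>i<p. {(q (Suc i) ! j, q (Suc i) ! Suc j) | j. j < m} \<union> {(q (Suc i) ! Suc j, q (Suc i) ! j) | j. j < m})"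
      using eq[of 0] eq[of "Suc _"] by (intro arg_cong2[of _ _ _ _ "(\<union>)"] SUP_cong) auto
    also have "\<dots> = ?R \<union> ?R\<inverse>" by blast
    finally show ?thesis using arcsP by simp
  qed
  ultimately have arcs: "parcs H = map_prod f f ` parcs (book_graph m (2 * m) p)"
    unfolding KA image_Un map_prod_converse by (simp add: image_setcompr2 glue)
  \<comment> \<open>The model graph has no isolated vertices, so the statement on vertices follows
    from the one on arcs.\<close>
  have FK: "Field (parcs (book_graph m (2 * m) p)) = pverts (book_graph m (2 * m) p)"
  proof
    show "Field (parcs (book_graph m (2 * m) p)) \<subseteq> pverts (book_graph m (2 * m) p)"
    proof -
      have "Suc j mod (2 * m) < 2 * m" for j using m by simp
      then show ?thesis unfolding K KA Field_def by blast
    qed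
    show "pverts (book_graph m (2 * m) p) \<subseteq> Field (parcs (book_graph m (2 * m) p))"
    proof
      fix x assume "x \<in> pverts (book_graph m (2 * m) p)"
      then obtain i j where "x = book_glue m (i, j)" "i < p" "j < 2 * m" unfolding K by blast
      then have "(x, book_glue m (i, Suc j mod (2 * m))) \<in> parcs (book_graph m (2 * m) p)"
        unfolding KA by blast
      then show "x \<in> Field (parcs (book_graph m (2 * m) p))" by (rule FieldI1)
    qed
  qed
  have "Field (map_prod f f ` A) = f ` Field A" for A :: "((nat \<times> nat) \<times> (nat \<times> nat)) set"
    by (simp add: Field_def image_Un Domain_fst Range_snd image_image)
  then have "pverts H = f ` pverts (book_graph m (2 * m) p)" using assms(2) FK arcs by simp
  moreover have "inj_on f (pverts (book_graph m (2 * m) p))"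
  proof -
    \<comment> \<open>A vertex of the common path is a hub or interior to page \<open>0\<close>,
      whereas an index beyond \<open>m\<close> denotes an interior vertex of another page.\<close>
    have *: False if "f (i, j) = f (i', j')" "j \<le> m" "m < j'" "j' < 2 * m" "i' < p" for i j i' j'
    proof -
      have "q (Suc i') ! (2 * m - j') \<in> set (h (Suc i'))" using inner[of "Suc i'" "2 * m - j'"] that by auto
      moreover have "q 0 ! j \<in> insert u (insert v (set (h 0)))"
        using ends[of 0] inner[of 0 j] that by (cases "j = 0 \<or> j = m") auto
      ultimately show False
        using that f1[of j i] f2[of j' i'] hneq[of 0 "Suc i'"] hub_notin(1,2)[OF bk hP[of "Suc i'"]] by auto
    qed
    have inj: "book_glue m (i, j) = book_glue m (i', j')"
      if eq: "f (i, j) = f (i', j')" and b: "i < p" "i' < p" "j < 2 * m" "j' < 2 * m" for i j i' j'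
    proof -
      consider "j \<le> m" "j' \<le> m" | "j \<le> m" "m < j'" | "m < j" "j' \<le> m" | "m < j" "m < j'" by linarith
      then show ?thesis
      proof cases
        case 1
        then have "j = j'" using eq f1 dist[of 0] len[of 0] by (simp add: nth_eq_iff_index_eq)
        then show ?thesis using 1 by (simp add: book_glue_def)
      next
        case 2
        then show ?thesis using *[OF eq] b by blast
      next
        case 3
        then show ?thesis using *[OF eq[symmetric]] b by blast
      next
        case 4
        have "q (Suc i) ! (2 * m - j) \<in> set (h (Suc i))" "q (Suc i') ! (2 * m - j') \<in> set (h (Suc i'))"
          using inner[of "Suc i" "2 * m - j"] inner[of "Suc i'" "2 * m - j'"] 4 b by auto
        moreover have "q (Suc i) ! (2 * m - j) = q (Suc i') ! (2 * m - j')"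
          using eq f2[of j i] f2[of j' i'] 4 b by simp
        ultimately have "i = i'" using hneq[of "Suc i" "Suc i'"] b by auto
        moreover from this have "2 * m - j = 2 * m - j'"
          using \<open>q (Suc i) ! (2 * m - j) = q (Suc i') ! (2 * m - j')\<close> dist[of "Suc i"] len[of "Suc i"] b 4
          by (simp add: nth_eq_iff_index_eq)
        moreover from this have "j = j'" using b by linarith
        ultimately show ?thesis by (simp add: book_glue_def)
      qed
    qed
    show ?thesis
    proof (rule inj_onI)
      fix x y
      assume "x \<in> pverts (book_graph m (2 * m) p)" "y \<in> pverts (book_graph m (2 * m) p)" and xy: "f x = f y"
      then obtain i j i' j' where "x = book_glue m (i, j)" "y = book_glue m (i', j')"
        "i < p" "i' < p" "j < 2 * m" "j' < 2 * m" unfolding K by (elim imageE SigmaE) simp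
      moreover from this(1,2) have "f (i, j) = f (i', j')" using xy by (simp only: glue)
      ultimately show "x = y" using inj by blast
    qed
  qed
  moreover have "parcs (book_graph m (2 * m) p) \<subseteq> pverts (book_graph m (2 * m) p) \<times> pverts (book_graph m (2 * m) p)"
    unfolding FK[symmetric] Field_def by auto
  ultimately show ?thesis using digraph_isoI[of f] arcs p by simp
qed

section \<open>Cycles around faces\<close>

text \<open>The path is extended edge by edge; when the new vertex already lies on it, the path is
  truncated there.\<close>

lemma is_path_of_rtrancl:
  assumes "(u, v) \<in> A\<^sup>*" "sym A"
  shows "v = u \<or> (\<exists>zs. is_path A u zs v)"
  using assms(1)
proof (induction rule: rtrancl_induct)
  case (step w v)
  have vw: "(w, v) \<in> A" "(v, w) \<in> A" using step.hyps assms(2) by (auto dest: symD)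
  show ?case
  proof (cases "v = u \<or> v = w")
    case False
    show ?thesis
    proof (cases "w = u")
      case True
      then have "is_path A u [] v" using vw False by (auto simp: is_path_def)
      then show ?thesis by blast
    next
      case wu: False
      then obtain zs where zs: "is_path A u zs w" using step.IH by blast
      show ?thesis
      proof (cases "v \<in> set zs")
        case True
        then obtain ys xs where "zs = ys @ v # xs" by (meson split_list)
        then show ?thesis using is_path_appendD(1) zs by fast
      next
        case notin: False
        have "is_path A w [] v" using vw False by (auto simp: is_path_def)
        from is_path_append[OF zs this] have "is_path A u (zs @ [w]) v"
          using False notin zs by (auto simp: is_path_def)
        then show ?thesis by blast
      qed
    qed
  qed (use step.IH in auto)
qed simp

lemma closing_edge_notin: "is_path A x zs y \<Longrightarrow> zs \<noteq> [] \<Longrightarrow> (x, y) \<notin> edges (x # zs @ [y])"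
  using edges_subset[of "zs @ [y]"] by (cases zs) (auto simp: is_path_def)

lemma is_cycle_obtain_path:
  assumes "is_cycle E c"
  obtains x zs y where "c = x # zs @ [y]" "zs \<noteq> []" "is_path E x zs y" "(y, x) \<in> E"
    "cedges c = edges (x # zs @ [y]) \<union> {(x, y), (y, x)}"
proof -
  obtain x c' where "c = x # c'" using assms by (cases c) (auto simp: is_cycle_def)
  moreover from this have "c' \<noteq> []" using assms by (auto simp: is_cycle_def)
  ultimately obtain zs y where c: "c = x # zs @ [y]" by (metis rev_exhaust)
  have "cedges c = edges (x # zs @ [y]) \<union> {(x, y), (y, x)}"
    using c edges_append[of "x # zs" y "[x]"] by auto
  moreover have "zs \<noteq> []" using assms c by (auto simp: is_cycle_def)
  ultimately show thesis using that c assms by (auto simp: is_cycle_def is_path_def)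
qed

text \<open>Finitely many points do not disconnect a connected open set of the plane. This allows
  vertices to be disregarded when a set of edges is to separate two points.\<close>

lemma connected_component_Compl_Un_finite:
  fixes S :: "complex set"
  assumes "closed S" "finite P" "connected_component (- S) a b" "a \<notin> P" "b \<notin> P"
  shows "connected_component (- (S \<union> P)) a b"
proof -
  let ?C = "connected_component_set (- S) a"
  have "topological_space_class.connected (?C - P)"
    using assms(1,2) by (intro connected_open_diff_countable)
      (auto simp: open_connected_component open_Compl countable_finite)
  moreover have "?C - P \<subseteq> - (S \<union> P)" using connected_component_subset by fastforce
  moreover have "a \<in> ?C" using assms(3) connected_component_in(1) connected_component_refl by fastforce
  moreover have "a \<in> ?C - P" "b \<in> ?C - P" using \<open>a \<in> ?C\<close> assms(3-5) by auto
  ultimately show ?thesis by (intro connected_componentI[of "?C - P"])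
qed

section \<open>Drawings of sets of edges\<close>

locale plane_graph =
  fixes G :: "'a pair_pre_digraph"
    and pos :: "'a \<Rightarrow> complex" and \<gamma> :: "'a \<times> 'a \<Rightarrow> real \<Rightarrow> complex"
  assumes graph: "pair_graph G" and plane: "plane_representation G pos \<gamma>"
begin

abbreviation curves :: "('a \<times> 'a) set \<Rightarrow> complex set" where
  "curves A \<equiv> \<Union>e\<in>A. path_image (\<gamma> e)"

lemma finite_parcs: "finite (parcs G)" and finite_pverts: "finite (pverts G)"
  using graph pair_fin_digraph.pair_finite_arcs pair_fin_digraph.pair_finite_verts
  unfolding pair_graph_def pair_digraph_def by blast+

lemma inj_pos: "inj_on pos (pverts G)"
  using plane by (simp add: plane_representation_def)

lemma edge_curve:
  assumes "(u, v) \<in> parcs G"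
  shows "arc (\<gamma> (u, v))" "pathstart (\<gamma> (u, v)) = pos u" "pathfinish (\<gamma> (u, v)) = pos v"
    "path_image (\<gamma> (u, v)) \<inter> pos ` pverts G = {pos u, pos v}"
    "path_image (\<gamma> (v, u)) = path_image (\<gamma> (u, v))"
    "u \<in> pverts G" "v \<in> pverts G" "u \<noteq> v" "(v, u) \<in> parcs G"
proof -
  have "\<forall>(u, v) \<in> parcs G.
        arc (\<gamma> (u, v)) \<and> pathstart (\<gamma> (u, v)) = pos u \<and> pathfinish (\<gamma> (u, v)) = pos v \<and>
        \<gamma> (v, u) = reversepath (\<gamma> (u, v)) \<and>
        path_image (\<gamma> (u, v)) \<inter> pos ` pverts G = {pos u, pos v}"
    using plane unfolding plane_representation_def by (elim conjE)
  from bspec[OF this assms]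
  show "arc (\<gamma> (u, v))" "pathstart (\<gamma> (u, v)) = pos u" "pathfinish (\<gamma> (u, v)) = pos v"
    "path_image (\<gamma> (u, v)) \<inter> pos ` pverts G = {pos u, pos v}"
    "path_image (\<gamma> (v, u)) = path_image (\<gamma> (u, v))" by auto
  interpret pair_graph G by (rule graph)
  show "u \<in> pverts G" "v \<in> pverts G" using assms in_arcsD1 in_arcsD2 by blast+
  show "u \<noteq> v" using pair_no_loops[OF assms] by simp
  show "(v, u) \<in> parcs G" using assms pair_sym_arcs by (auto simp: symmetric_def dest: symD)
qed

lemma edge_curves_Int:
  assumes "(u, v) \<in> parcs G" "(x, y) \<in> parcs G" "(x, y) \<noteq> (u, v)" "(x, y) \<noteq> (v, u)"
  shows "path_image (\<gamma> (u, v)) \<inter> path_image (\<gamma> (x, y)) \<subseteq> pos ` ({u, v} \<inter> {x, y})"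
proof
  have "\<forall>e \<in> parcs G. \<forall>e' \<in> parcs G. e' \<noteq> e \<and> e' \<noteq> prod.swap e \<longrightarrow>
        path_image (\<gamma> e) \<inter> path_image (\<gamma> e') \<subseteq> pos ` pverts G"
    using plane unfolding plane_representation_def by (elim conjE)
  with assms have sub: "path_image (\<gamma> (u, v)) \<inter> path_image (\<gamma> (x, y)) \<subseteq> pos ` pverts G"
    by (metis swap_simp)
  fix z assume "z \<in> path_image (\<gamma> (u, v)) \<inter> path_image (\<gamma> (x, y))"
  with sub have "z \<in> {pos u, pos v}" "z \<in> {pos x, pos y}"
    using edge_curve(4)[OF assms(1)] edge_curve(4)[OF assms(2)] by blast+
  then show "z \<in> pos ` ({u, v} \<inter> {x, y})"
    using inj_pos edge_curve(6,7)[OF assms(1)] edge_curve(6,7)[OF assms(2)]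
    by (auto dest: inj_onD)
qed

text \<open>Symmetry of \<open>A\<close> keeps the reversals of its arcs out of \<open>B\<close>;
  they are drawn as the same curves and would meet \<open>A\<close> in more than vertices.\<close>

lemma curves_Int:
  assumes "A \<subseteq> parcs G" "B \<subseteq> parcs G" "sym A" "A \<inter> B = {}"
  shows "curves A \<inter> curves B \<subseteq> pos ` (Field A \<inter> Field B)"
proof
  fix z assume "z \<in> curves A \<inter> curves B"
  then obtain u v x y where *: "(u, v) \<in> A" "(x, y) \<in> B"
    "z \<in> path_image (\<gamma> (u, v)) \<inter> path_image (\<gamma> (x, y))" by auto
  have "(x, y) \<noteq> (u, v)" "(x, y) \<noteq> (v, u)" using * assms(3,4) by (auto dest: symD)
  then have "z \<in> pos ` ({u, v} \<inter> {x, y})" using edge_curves_Int * assms(1,2) by blast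
  moreover have "{u, v} \<subseteq> Field A" "{x, y} \<subseteq> Field B" using * by (auto simp: Field_def)
  ultimately show "z \<in> pos ` (Field A \<inter> Field B)" by blast
qed

lemma compact_curves: "A \<subseteq> parcs G \<Longrightarrow> compact (curves A)"
  using finite_parcs edge_curve(1)
  by (intro compact_UN) (auto intro: finite_subset compact_arc_image)

lemma closed_curves: "A \<subseteq> parcs G \<Longrightarrow> closed (curves A)"
  by (simp add: compact_curves compact_imp_closed)

lemma pos_in_curves: "A \<subseteq> parcs G \<Longrightarrow> x \<in> Field A \<Longrightarrow> pos x \<in> curves A"
proof -
  assume A: "A \<subseteq> parcs G" and "x \<in> Field A"
  then obtain y where "(x, y) \<in> A \<or> (y, x) \<in> A" by (auto simp: Field_def)
  then show ?thesis
  proof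
    assume "(x, y) \<in> A"
    then show ?thesis using edge_curve(4)[of x y] A by blast
  next
    assume "(y, x) \<in> A"
    then show ?thesis using edge_curve(4)[of y x] A by blast
  qed
qed

lemma curves_pair: "(u, v) \<in> parcs G \<Longrightarrow> curves {(u, v), (v, u)} = path_image (\<gamma> (u, v))"
  using edge_curve(5) by simp

lemma path_arc:
  assumes "distinct xs" "2 \<le> length xs" "edges xs \<subseteq> parcs G"
  shows "\<exists>g. arc g \<and> pathstart g = pos (hd xs) \<and> pathfinish g = pos (last xs) \<and>
    path_image g = curves (edges xs)"
  using assms
proof (induction xs rule: edges.induct)
  case (3 x y zs)
  then have xy: "(x, y) \<in> parcs G" by simp
  note e = edge_curve[OF xy]
  show ?case
  proof (cases "zs = []")
    case True
    then show ?thesis using e by auto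
  next
    case False
    then have "2 \<le> length (y # zs)" by (cases zs) auto
    then obtain g where g: "arc g" "pathstart g = pos y" "pathfinish g = pos (last (y # zs))"
      "path_image g = curves (edges (y # zs))"
      using 3 by auto
    have dis: "edges (y # zs) \<inter> {(x, y), (y, x)} = {}"
      using edges_subset[of "y # zs"] "3.prems"(1) by auto
    have "path_image g \<inter> path_image (\<gamma> (x, y)) \<subseteq> pos ` (Field (edges (y # zs)) \<inter> Field {(x, y), (y, x)})"
      using curves_Int[OF _ _ sym_edges dis] curves_pair[OF xy] g(4) "3.prems"(3) xy e(9) by auto
    also have "\<dots> \<subseteq> {pos y}"
      using edges_subset[of "y # zs"] "3.prems"(1) by (auto simp: Field_def)
    finally have "arc (\<gamma> (x, y) +++ g)" using e(1-3) g by (intro arc_join) auto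
    moreover have "path_image (\<gamma> (x, y) +++ g) = curves (edges (x # y # zs))"
      using e(3,5) g by (auto simp: path_image_join)
    ultimately show ?thesis using e(2) g(3) by (intro exI[of _ "\<gamma> (x, y) +++ g"]) auto
  qed
qed auto

lemma cycle_simple_path:
  assumes "is_cycle (parcs G) c"
  obtains g where "simple_path g" "pathfinish g = pathstart g" "path_image g = curves (cedges c)"
proof -
  obtain x zs y where c: "c = x # zs @ [y]" "zs \<noteq> []" "is_path (parcs G) x zs y" "(y, x) \<in> parcs G"
    "cedges c = edges (x # zs @ [y]) \<union> {(x, y), (y, x)}"
    using is_cycle_obtain_path[OF assms] .
  note e = edge_curve[OF c(4)]
  obtain g where g: "arc g" "pathstart g = pos x" "pathfinish g = pos y"
    "path_image g = curves (edges (x # zs @ [y]))"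
    using path_arc[of "x # zs @ [y]"] c(3) by (auto simp: is_path_def)
  have dis: "edges (x # zs @ [y]) \<inter> {(y, x), (x, y)} = {}"
    using closing_edge_notin[OF c(3,2)] sym_edges[of "x # zs @ [y]"] by (auto dest: symD)
  have "path_image g \<inter> path_image (\<gamma> (y, x)) \<subseteq> pos ` Field {(y, x), (x, y)}"
    using curves_Int[OF _ _ sym_edges dis] curves_pair[OF c(4)] g(4) c(3,4) e(9)
    by (auto simp: is_path_def)
  then have "simple_path (g +++ \<gamma> (y, x))"
    using e(1-3) g by (intro simple_path_join_loop) (auto simp: Field_def)
  moreover have "path_image (g +++ \<gamma> (y, x)) = curves (cedges c)"
    using e(2,5) g c(5) by (auto simp: path_image_join)
  ultimately show thesis using that e(3) g(2) by fastforce
qed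

section \<open>Separation of points by edges\<close>

lemma connected_Compl_arc_piece:
  assumes "e \<in> parcs G" "0 \<le> s" "t \<le> 1"
  shows "topological_space_class.connected (- \<gamma> e ` {s..t})"
proof -
  obtain u v where e: "e = (u, v)" by (cases e)
  have "arc (\<gamma> e)" using edge_curve(1) assms(1) e by simp
  then have "inj_on (\<gamma> e) {s..t}" "continuous_on {s..t} (\<gamma> e)"
    using assms(2,3) by (auto simp: arc_def path_def intro: inj_on_subset continuous_on_subset)
  then have "\<gamma> e ` {s..t} homeomorphic {s..t}"
    using homeomorphic_compact[of "{s..t}" "\<gamma> e"] homeomorphic_sym by blast
  then show ?thesis
    by (rule connected_complement_homeomorphic_convex_compact) auto
qed

lemma connected_component_Compl_edge:
  assumes "e \<in> parcs G" "a \<notin> path_image (\<gamma> e)" "b \<notin> path_image (\<gamma> e)"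
  shows "connected_component (- path_image (\<gamma> e)) a b"
  using connected_Compl_arc_piece[OF assms(1), of 0 1] assms(2,3)
  by (auto simp: path_image_def connected_iff_connected_component)

text \<open>That the cycle consists of arcs of \<open>A\<close> itself is essential for the
  application, where \<open>A\<close> contains only edges touching the frontier of a face.\<close>

lemma separating_cycle:
  assumes "A \<subseteq> parcs G" "sym A" "a \<notin> curves A" "b \<notin> curves A"
    and "\<not> connected_component (- curves A) a b"
  shows "\<exists>c. is_cycle A c \<and> \<not> connected_component (- curves (cedges c)) a b"
  using assms
proof (induction "card A" arbitrary: A rule: less_induct)
  case less
  have fin: "finite A" using less.prems(1) finite_parcs finite_subset by blast
  have "connected_component UNIV a b" by (intro connected_componentI[of UNIV]) auto
  then have "A \<noteq> {}" using less.prems(5) by auto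
  then obtain u v where uv: "(u, v) \<in> A" by auto
  then have uvG: "(u, v) \<in> parcs G" and vu: "(v, u) \<in> A" using less.prems(1,2) by (auto dest: symD)
  note e = edge_curve[OF uvG]
  define A' where "A' = A - {(u, v), (v, u)}"
  have A'G: "A' \<subseteq> parcs G" and symA': "sym A'"
    using less.prems(1,2) by (auto simp: A'_def sym_def)
  have A: "A = A' \<union> {(u, v), (v, u)}" using uv vu by (auto simp: A'_def)
  have curvesA: "curves A = curves A' \<union> path_image (\<gamma> (u, v))" unfolding A using e(5) by auto
  have sub: "curves B \<subseteq> curves A" if "B \<subseteq> A" for B using that by blast
  have PI: "path_image (\<gamma> (u, v)) \<inter> curves B \<subseteq> pos ` ({u, v} \<inter> Field B)" if "B \<subseteq> A'" for B
  proof -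
    have "curves {(u, v), (v, u)} \<inter> curves B \<subseteq> pos ` (Field {(u, v), (v, u)} \<inter> Field B)"
      using uvG e(9) A'G that by (intro curves_Int) (auto simp: A'_def sym_def)
    then show ?thesis using curves_pair[OF uvG] by (simp add: Field_def insert_commute)
  qed
  show ?case
  proof (cases "connected_component (- curves A') a b")
    case False
    have "card A' < card A" using fin uv by (intro psubset_card_mono) (auto simp: A'_def)
    then obtain c where "is_cycle A' c" "\<not> connected_component (- curves (cedges c)) a b"
      using less.hyps[OF _ A'G symA' _ _ False] less.prems(3,4) sub[of A'] A'_def by blast
    then show ?thesis by (auto simp: A'_def is_cycle_def)
  next
    case conn: True
    show ?thesis
    proof (cases "(u, v) \<in> A'\<^sup>*")
      case True
      then obtain zs where zs: "is_path A' u zs v"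
        using is_path_of_rtrancl[OF _ symA'] e(8) by blast
      then have ne: "zs \<noteq> []" by (auto simp: is_path_def A'_def)
      define c where "c = u # zs @ [v]"
      have ce: "cedges c = edges c \<union> {(u, v), (v, u)}"
        using edges_append[of "u # zs" v "[u]"] by (auto simp: c_def)
      have cA': "edges c \<subseteq> A'" using zs by (auto simp: c_def is_path_def)
      have cyc: "is_cycle A c"
        unfolding is_cycle_def ce using zs ne A cA' by (cases zs) (auto simp: c_def is_path_def)
      have ccurves: "curves (cedges c) = curves (edges c) \<union> path_image (\<gamma> (u, v))"
        unfolding ce using e(5) by auto
      have "\<not> connected_component (- curves (cedges c)) a b"
      proof
        assume cc: "connected_component (- curves (cedges c)) a b"
        have Fc: "u \<in> Field (edges c)" "v \<in> Field (edges c)"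
          using Field_edges[of c] by (auto simp: c_def)
        have cG: "edges c \<subseteq> parcs G" using cA' A'G by blast
        have "{pos u, pos v} \<subseteq> curves (edges c)" using pos_in_curves[OF cG] Fc by blast
        \<comment> \<open>Both ends of the removed edge lie on the path already, so the edge
          contributes nothing to the intersection.\<close>
        then have int: "curves A' \<inter> curves (cedges c) = curves (edges c)"
          using PI[of A'] cA' unfolding ccurves by blast
        obtain g where "arc g" "path_image g = curves (edges c)"
          using path_arc[of c] cG zs by (auto simp: c_def is_path_def)
        then have "topological_space_class.connected (curves A' \<inter> curves (cedges c))"
          unfolding int by (metis connected_arc_image)
        from Janiszewski[OF compact_curves[OF A'G] _ this conn cc] have
          "connected_component (- (curves A' \<union> curves (cedges c))) a b"
          using closed_curves[of "cedges c"] cyc less.prems(1) by (auto simp: is_cycle_def)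
        moreover have "curves A' \<union> curves (cedges c) = curves A"
          unfolding curvesA ccurves using cA' by blast
        ultimately show False using less.prems(5) by simp
      qed
      then show ?thesis using cyc by blast
    next
      case False
      \<comment> \<open>\<open>R\<close> is the side of the bridge that contains \<open>u\<close>.
        The bridge meets the edges on this side at most in \<open>pos u\<close>, and the remaining
        edges meet the union of the two at most in \<open>pos v\<close>; an empty intersection
        counts as connected.\<close>
      define R where "R = {x. (u, x) \<in> A'\<^sup>*}"
      define A1 where "A1 = {e \<in> A'. fst e \<in> R}"
      have closedR: "x \<in> R \<longleftrightarrow> y \<in> R" if "(x, y) \<in> A'" for x y
        using that symA' unfolding R_def by (metis mem_Collect_eq rtrancl.rtrancl_into_rtrancl symD)
      have symA1: "sym A1" using symA' closedR by (auto simp: A1_def sym_def)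
      have F1: "Field A1 \<subseteq> R" and F2: "Field (A' - A1) \<inter> R = {}"
        using closedR by (auto simp: A1_def Field_def)
      have uR: "u \<in> R" "v \<notin> R" using False by (auto simp: R_def)
      have A1G: "A1 \<subseteq> parcs G" "A' - A1 \<subseteq> parcs G" using A'G by (auto simp: A1_def)
      have c1: "connected_component (- curves A1) a b" "connected_component (- curves (A' - A1)) a b"
        using conn by (rule connected_component_of_subset, auto simp: A1_def)+
      have ce: "connected_component (- path_image (\<gamma> (u, v))) a b"
        using connected_component_Compl_edge[OF uvG] less.prems(3,4) uv by blast
      have "path_image (\<gamma> (u, v)) \<inter> curves A1 \<subseteq> pos ` ({u, v} \<inter> Field A1)"
        by (rule PI) (auto simp: A1_def)
      then have "curves A1 \<inter> path_image (\<gamma> (u, v)) \<subseteq> {pos u}" using F1 uR by auto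
      then have "topological_space_class.connected (curves A1 \<inter> path_image (\<gamma> (u, v)))"
        using subset_singletonD by fastforce
      from Janiszewski[OF compact_curves[OF A1G(1)] _ this c1(1) ce]
      have c2: "connected_component (- (curves A1 \<union> path_image (\<gamma> (u, v)))) a b"
        using e(1) closed_arc_image by blast
      have "path_image (\<gamma> (u, v)) \<inter> curves (A' - A1) \<subseteq> pos ` ({u, v} \<inter> Field (A' - A1))"
        by (rule PI) auto
      moreover have "curves A1 \<inter> curves (A' - A1) \<subseteq> pos ` (Field A1 \<inter> Field (A' - A1))"
        using A1G symA1 by (intro curves_Int) auto
      ultimately have "curves (A' - A1) \<inter> (curves A1 \<union> path_image (\<gamma> (u, v))) \<subseteq> {pos v}"
        using F1 F2 uR by blast
      then have "topological_space_class.connected (curves (A' - A1) \<inter> (curves A1 \<union> path_image (\<gamma> (u, v))))"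
        using subset_singletonD by fastforce
      from Janiszewski[OF compact_curves[OF A1G(2)] _ this c1(2) c2]
      have "connected_component (- (curves (A' - A1) \<union> (curves A1 \<union> path_image (\<gamma> (u, v))))) a b"
        using e(1) closed_arc_image closed_curves[OF A1G(1)] by blast
      moreover have "curves (A' - A1) \<union> (curves A1 \<union> path_image (\<gamma> (u, v))) = curves A"
        unfolding curvesA by (auto simp: A1_def)
      ultimately show ?thesis using less.prems(5) by simp
    qed
  qed
qed

section \<open>Faces and cycles around them\<close>

lemma drawing_eq: "drawing G pos \<gamma> = pos ` pverts G \<union> curves (parcs G)"
  by (simp add: drawing_def)

lemma compact_drawing: "compact (drawing G pos \<gamma>)"
  unfolding drawing_eq
  by (intro compact_Un compact_curves) (simp_all add: finite_imp_compact finite_pverts)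

lemma drawing_cycle:
  assumes "is_cycle (parcs G) c"
  shows "drawing \<lparr>pverts = set c, parcs = cedges c\<rparr> pos \<gamma> = curves (cedges c)"
proof -
  have "pos ` set c \<subseteq> curves (cedges c)"
    using pos_in_curves[of "cedges c"] Field_cedges[OF assms] assms by (auto simp: is_cycle_def)
  then show ?thesis by (auto simp: drawing_def)
qed

lemma curves_subset_drawing: "A \<subseteq> parcs G \<Longrightarrow> curves A \<subseteq> drawing G pos \<gamma>"
  unfolding drawing_eq by blast

lemma faceD:
  assumes "F \<in> faces G pos \<gamma>"
  shows "open F" "topological_space_class.connected F" "F \<noteq> {}" "F \<inter> drawing G pos \<gamma> = {}"
    "frontier F \<subseteq> drawing G pos \<gamma>"
proof -
  have F: "F \<in> components (- drawing G pos \<gamma>)" using assms by (simp add: faces_def)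
  have op: "open (- drawing G pos \<gamma>)" using compact_drawing compact_imp_closed by blast
  show "open F" using F op open_components by blast
  show "topological_space_class.connected F" "F \<noteq> {}" "F \<inter> drawing G pos \<gamma> = {}"
    using F in_components_connected in_components_nonempty in_components_subset by blast+
  show "frontier F \<subseteq> drawing G pos \<gamma>"
    using frontier_of_components_closed_complement[OF compact_imp_closed[OF compact_drawing] F] by blast
qed

lemma connected_component_meets_frontier:
  assumes "connected_component S a b" "a \<in> F" "b \<notin> F"
  obtains z where "z \<in> S" "z \<in> frontier F"
proof -
  obtain T where T: "topological_space_class.connected T" "T \<subseteq> S" "a \<in> T" "b \<in> T"
    using assms(1) by (auto simp: connected_component_def)
  then have "T \<inter> frontier F \<noteq> {}" using assms(2,3) by (intro connected_Int_frontier) auto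
  then show thesis using T(2) that by blast
qed

text \<open>
  Suppose a piece of the edge misses the closure of \<open>F\<close>. Points \<open>p \<in> F\<close> and \<open>q\<close> outside the cycle,
  both close to \<open>x\<close>, are not separated by the drawing without this piece: what is left of the edge
  are two arcs attached at one end only. But the frontier of \<open>F\<close> lies in that drawing.
\<close>

lemma edge_subset_closure_face:
  assumes F: "F \<in> faces G pos \<gamma>" and c: "is_cycle (parcs G) c"
    and inside: "F \<subseteq> inside (curves (cedges c))"
    and uv: "(u, v) \<in> cedges c"
    and x: "x \<in> path_image (\<gamma> (u, v))" "x \<notin> pos ` pverts G" "x \<in> frontier F"
  shows "path_image (\<gamma> (u, v)) \<subseteq> closure F"
proof (rule ccontr)
  assume "\<not> path_image (\<gamma> (u, v)) \<subseteq> closure F"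
  then obtain t where t: "t \<in> {0..1}" "\<gamma> (u, v) t \<notin> closure F"
    unfolding path_image_def by blast
  have uvG: "(u, v) \<in> parcs G" using uv c by (auto simp: is_cycle_def)
  note e = edge_curve[OF uvG]
  have cont: "continuous_on {0..1} (\<gamma> (u, v))" and inj: "inj_on (\<gamma> (u, v)) {0..1}"
    using e(1) by (auto simp: arc_def path_def)
  have "\<exists>d>0. \<forall>s\<in>{0..1}. \<bar>s - t\<bar> < d \<longrightarrow> \<gamma> (u, v) s \<notin> closure F"
  proof -
    have "openin (top_of_set {0..1}) ({0..1} \<inter> \<gamma> (u, v) -` (- closure F))"
      using cont by (intro continuous_openin_preimage_gen) auto
    moreover have "t \<in> {0..1} \<inter> \<gamma> (u, v) -` (- closure F)" using t by auto
    ultimately obtain d where "d > 0" "\<forall>s\<in>{0..1}. dist s t < d \<longrightarrow> s \<in> {0..1} \<inter> \<gamma> (u, v) -` (- closure F)"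
      unfolding openin_euclidean_subtopology_iff by blast
    then show ?thesis by (auto simp: dist_real_def)
  qed
  then obtain d where d: "d > 0" "\<And>s. s \<in> {0..1} \<Longrightarrow> \<bar>s - t\<bar> < d \<Longrightarrow> \<gamma> (u, v) s \<notin> closure F" by blast
  \<comment> \<open>Half of \<open>d\<close> keeps the interval within the neighbourhood of
    \<open>t\<close>, and clipping it to the parameter range leaves it nondegenerate even if
    \<open>t\<close> is \<open>0\<close> or \<open>1\<close>.\<close>
  define t1 where "t1 = max 0 (t - d / 2)"
  define t2 where "t2 = min 1 (t + d / 2)"
  have t12: "0 \<le> t1" "t1 < t2" "t2 \<le> 1" using t d by (auto simp: t1_def t2_def)
  have between: "\<gamma> (u, v) s \<notin> closure F" if "t1 < s" "s < t2" for s
    using d that t12 by (intro d(2)) (auto simp: t1_def t2_def)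
  define K1 where "K1 = \<gamma> (u, v) ` {0..t1}"
  define K2 where "K2 = \<gamma> (u, v) ` {t2..1}"
  \<comment> \<open>The drawing without the edge but with its end vertices. The initial piece
    \<open>K1\<close> of the edge can meet it only in \<open>pos u\<close>, the final piece
    \<open>K2\<close> only in \<open>pos v\<close>.\<close>
  define S where "S = curves (parcs G - {(u, v), (v, u)}) \<union> pos ` pverts G"
  have K: "K1 \<subseteq> path_image (\<gamma> (u, v))" "K2 \<subseteq> path_image (\<gamma> (u, v))"
    using t12 by (auto simp: K1_def K2_def path_image_def)
  have compK: "compact K1" "compact K2"
    unfolding K1_def K2_def using cont t12
    by (auto intro!: compact_continuous_image intro: continuous_on_subset)
  have compS: "compact S"
    unfolding S_def by (intro compact_Un compact_curves) (auto simp: finite_imp_compact finite_pverts)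
  have ends: "\<gamma> (u, v) 0 = pos u" "\<gamma> (u, v) 1 = pos v"
    using e(2,3) by (auto simp: pathstart_def pathfinish_def)
  have "curves {(u, v), (v, u)} \<inter> curves (parcs G - {(u, v), (v, u)}) \<subseteq>
    pos ` (Field {(u, v), (v, u)} \<inter> Field (parcs G - {(u, v), (v, u)}))"
    using uvG e(9) by (intro curves_Int) (auto simp: sym_def)
  then have SP: "S \<inter> path_image (\<gamma> (u, v)) \<subseteq> {pos u, pos v}"
    unfolding S_def using e(4) curves_pair[OF uvG] by (auto simp: Field_def)
  have "pos v \<notin> K1"
  proof
    assume "pos v \<in> K1"
    then obtain s where "s \<in> {0..t1}" "\<gamma> (u, v) s = \<gamma> (u, v) 1" using ends by (auto simp: K1_def)
    then show False using inj_onD[OF inj, of s 1] t12 by auto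
  qed
  then have "S \<inter> K1 \<subseteq> {pos u}" using SP K by blast
  then have con1: "topological_space_class.connected (S \<inter> K1)" using subset_singletonD by fastforce
  have "pos u \<notin> K2"
  proof
    assume "pos u \<in> K2"
    then obtain s where "s \<in> {t2..1}" "\<gamma> (u, v) s = \<gamma> (u, v) 0" using ends by (auto simp: K2_def)
    then show False using inj_onD[OF inj, of s 0] t12 by auto
  qed
  moreover have "K1 \<inter> K2 = {}"
  proof (rule ccontr)
    assume "K1 \<inter> K2 \<noteq> {}"
    then obtain s s' where "s \<in> {0..t1}" "s' \<in> {t2..1}" "\<gamma> (u, v) s = \<gamma> (u, v) s'"
      unfolding K1_def K2_def by blast
    then show False using inj_onD[OF inj, of s s'] t12 by auto
  qed
  ultimately have "(S \<union> K1) \<inter> K2 \<subseteq> {pos v}" using SP K by blast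
  then have con2: "topological_space_class.connected ((S \<union> K1) \<inter> K2)" using subset_singletonD by fastforce
  \<comment> \<open>As \<open>x\<close> lies on the edge and is not a vertex, some ball around it
    avoids \<open>S\<close>; inside this ball \<open>p\<close> and \<open>q\<close> can be
    joined.\<close>
  have "x \<notin> S" using SP x e(6,7) by blast
  moreover have "open (- S)" using compS compact_imp_closed by blast
  ultimately obtain r where r: "r > 0" "ball x r \<subseteq> - S" using openE by blast
  obtain p where p: "p \<in> F" "p \<in> ball x r"
    using x(3) r(1) by (auto simp: frontier_def closure_approachable dist_commute)
  obtain g where g: "simple_path g" "pathfinish g = pathstart g" "path_image g = curves (cedges c)"
    using cycle_simple_path[OF c] .
  \<comment> \<open>By the Jordan curve theorem every point of the cycle is a limit of points
    outside it; for \<open>x\<close> this supplies \<open>q\<close>.\<close>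
  have "frontier (outside (curves (cedges c))) = curves (cedges c)"
    using Jordan_inside_outside[OF g(1,2)] g(3) by simp
  moreover have uvc: "path_image (\<gamma> (u, v)) \<subseteq> curves (cedges c)" using uv by blast
  ultimately have "x \<in> closure (outside (curves (cedges c)))" using x(1) by (auto simp: frontier_def)
  then obtain q where q: "q \<in> outside (curves (cedges c))" "q \<in> ball x r"
    using r(1) by (auto simp: closure_approachable dist_commute)
  have qF: "q \<notin> F" using q(1) inside inside_Int_outside by blast
  have "p \<notin> path_image (\<gamma> (u, v))"
    using p(1) faceD(4)[OF F] curves_subset_drawing[of "{(u, v)}"] uvG by auto
  moreover have "q \<notin> path_image (\<gamma> (u, v))" using q(1) uvc outside_no_overlap by blast
  ultimately have notin: "p \<in> - K1" "q \<in> - K1" "p \<in> - K2" "q \<in> - K2" using K by blast+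
  have "topological_space_class.connected (- K1)" "topological_space_class.connected (- K2)"
    using connected_Compl_arc_piece[OF uvG] t12 by (simp_all add: K1_def K2_def)
  then have pq: "connected_component (- K1) p q" "connected_component (- K2) p q"
    using notin connected_iff_connected_component by metis+
  have "connected_component (- S) p q"
    using r(2) p(2) q(2) by (intro connected_componentI[of "ball x r"]) auto
  from Janiszewski[OF compS compact_imp_closed[OF compK(1)] con1 this pq(1)]
  have "connected_component (- (S \<union> K1)) p q" .
  from Janiszewski[OF compact_Un[OF compS compK(1)] compact_imp_closed[OF compK(2)] con2 this pq(2)]
  have "connected_component (- (S \<union> K1 \<union> K2)) p q" .
  then obtain z where z: "z \<notin> S \<union> K1 \<union> K2" "z \<in> frontier F"
    using connected_component_meets_frontier[OF _ p(1) qF] by blast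
  then have "z \<in> path_image (\<gamma> (u, v))"
    using faceD(5)[OF F] e(5) unfolding drawing_eq S_def by blast
  then obtain s where s: "s \<in> {0..1}" "z = \<gamma> (u, v) s" by (auto simp: path_image_def)
  then have "t1 < s" "s < t2" using z(1) by (force simp: K1_def K2_def)+
  then have "z \<notin> closure F" using between s by blast
  then show False using z(2) by (simp add: frontier_def)
qed

lemma face_has_cycle:
  assumes F: "F \<in> faces G pos \<gamma>"
  shows "\<exists>c. is_cycle (parcs G) c \<and> curves (cedges c) \<subseteq> frontier F \<and> F \<subseteq> inside (curves (cedges c))"
proof -
  let ?W = "drawing G pos \<gamma>"
  note f = faceD[OF F]
  obtain a where a: "a \<in> F" using f(3) by blast
  have "outside ?W \<noteq> {}"
    using compact_drawing by (intro outside_bounded_nonempty compact_imp_bounded)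
  then obtain b where b: "b \<in> outside ?W" by blast
  have bW: "b \<notin> ?W" using b outside_no_overlap by blast
  have bF: "b \<notin> F"
  proof
    assume "b \<in> F"
    moreover obtain x where "F = connected_component_set (- ?W) x"
      using F unfolding faces_def components_iff by blast
    ultimately have "connected_component_set (- ?W) b = F"
      using connected_component_eq by blast
    then show False using b F by (simp add: outside_def faces_def)
  qed
  \<comment> \<open>Leaving out the edges that touch the frontier in vertices only ensures that
    every edge of a cycle found in \<open>H\<close> has the point \<open>x\<close> demanded by
    \<open>edge_subset_closure_face\<close>.\<close>
  define H where "H = {e \<in> parcs G. \<not> path_image (\<gamma> e) \<inter> frontier F \<subseteq> pos ` pverts G}"
  have HG: "H \<subseteq> parcs G" by (auto simp: H_def)
  have symH: "sym H" using edge_curve(5,9) by (auto simp: H_def sym_def)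
  have fr: "frontier F \<subseteq> curves H \<union> pos ` pverts G"
    using f(5) unfolding drawing_eq H_def by blast
  have aW: "a \<notin> ?W" using a f(4) by blast
  have "\<not> connected_component (- (curves H \<union> pos ` pverts G)) a b"
    using connected_component_meets_frontier[OF _ a bF] fr by blast
  then have "\<not> connected_component (- curves H) a b"
    using connected_component_Compl_Un_finite[OF closed_curves[OF HG], of "pos ` pverts G"]
      finite_pverts aW bW unfolding drawing_eq by blast
  moreover have "a \<notin> curves H" "b \<notin> curves H"
    using aW bW curves_subset_drawing[OF HG] by blast+
  ultimately obtain c where c: "is_cycle H c" "\<not> connected_component (- curves (cedges c)) a b"
    using separating_cycle[OF HG symH] by blast
  have cG: "is_cycle (parcs G) c" using c(1) HG by (auto simp: is_cycle_def)
  let ?C = "curves (cedges c)"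
  have CW: "?C \<subseteq> ?W" using cG by (intro curves_subset_drawing) (simp add: is_cycle_def)
  have bout: "b \<in> outside ?C" using b outside_mono[OF CW] by blast
  obtain g where g: "simple_path g" "pathfinish g = pathstart g" "path_image g = ?C"
    using cycle_simple_path[OF cG] .
  have "topological_space_class.connected (outside ?C)"
    using Jordan_inside_outside[OF g(1,2)] g(3) by simp
  then have "a \<notin> outside ?C"
    using c(2) bout by (meson connected_componentI outside_no_overlap disjoint_eq_subset_Compl inf_commute)
  then have ain: "a \<in> inside ?C" using inside_Un_outside[of ?C] aW CW by blast
  have Fin: "F \<subseteq> inside ?C"
  proof
    fix y assume "y \<in> F"
    then have "connected_component (- ?C) a y"
      using f(2,4) a CW by (intro connected_componentI[of F]) auto
    then show "y \<in> inside ?C" using ain by (rule inside_same_component)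
  qed
  have "?C \<subseteq> frontier F"
  proof
    fix z assume "z \<in> ?C"
    then obtain u v where uv: "(u, v) \<in> cedges c" "z \<in> path_image (\<gamma> (u, v))" by auto
    then have "(u, v) \<in> H" using c(1) by (auto simp: is_cycle_def)
    then obtain x where "x \<in> path_image (\<gamma> (u, v))" "x \<notin> pos ` pverts G" "x \<in> frontier F"
      by (auto simp: H_def)
    from edge_subset_closure_face[OF F cG Fin uv(1) this] have "z \<in> closure F" using uv(2) by blast
    moreover have "z \<notin> F" using \<open>z \<in> ?C\<close> CW f(4) by blast
    ultimately show "z \<in> frontier F" using f(1) by (simp add: frontier_def interior_open)
  qed
  then show ?thesis using cG Fin by blast
qed

section \<open>Uniqueness of the bounding cycle\<close>

lemma edge_curve_noncrossing:
  assumes "(u, v) \<in> parcs G" "A \<subseteq> parcs G" "sym A" "path_image (\<gamma> (u, v)) \<subseteq> curves A"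
  shows "(u, v) \<in> A"
proof (rule ccontr)
  assume "(u, v) \<notin> A"
  note e = edge_curve[OF assms(1)]
  have "A \<inter> {(u, v), (v, u)} = {}" using \<open>(u, v) \<notin> A\<close> assms(3) by (auto dest: symD)
  then have "curves A \<inter> curves {(u, v), (v, u)} \<subseteq> pos ` (Field A \<inter> Field {(u, v), (v, u)})"
    using assms(1-3) e(9) by (intro curves_Int) auto
  then have "path_image (\<gamma> (u, v)) \<subseteq> {pos u, pos v}"
    using assms(4) curves_pair[OF assms(1)] by (auto simp: Field_def)
  \<comment> \<open>The image of an interval under an injective map is infinite and does not fit
    into two points.\<close>
  then have "finite (\<gamma> (u, v) ` {0..1})" unfolding path_image_def by (rule finite_subset) simp
  moreover have "inj_on (\<gamma> (u, v)) {0..1}" using e(1) by (simp add: arc_def)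
  ultimately have "finite {0..1 :: real}" by (simp add: finite_image_iff)
  then show False using infinite_Icc[of 0 "1 :: real"] by simp
qed

lemma cycle_Jordan:
  assumes "is_cycle (parcs G) c"
  shows "topological_space_class.connected (outside (curves (cedges c)))"
    "\<not> bounded (outside (curves (cedges c)))"
    "frontier (inside (curves (cedges c))) = curves (cedges c)"
    "frontier (outside (curves (cedges c))) = curves (cedges c)"
proof -
  obtain g where g: "simple_path g" "pathfinish g = pathstart g" "path_image g = curves (cedges c)"
    using cycle_simple_path[OF assms] .
  note J = Jordan_inside_outside[OF g(1,2), unfolded g(3)]
  show "topological_space_class.connected (outside (curves (cedges c)))" using J by (elim conjE)
  show "\<not> bounded (outside (curves (cedges c)))" using J by (elim conjE)
  show "frontier (inside (curves (cedges c))) = curves (cedges c)" using J by (elim conjE)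
  show "frontier (outside (curves (cedges c))) = curves (cedges c)" using J by (elim conjE)
qed

text \<open>The frontier of \<open>F\<close> stays within the cycle and its inside, so the outside,
  being connected and unbounded, is not met by \<open>curves A\<close>. Applied in both directions
  to two candidates for the bounding cycle, this makes their outsides equal, and each cycle is the
  frontier of its outside.\<close>

lemma outside_cycle_subset:
  assumes "curves A \<subseteq> frontier F" "is_cycle (parcs G) c" "F \<subseteq> inside (curves (cedges c))"
  shows "outside (curves (cedges c)) \<subseteq> outside (curves A)"
proof
  let ?I = "inside (curves (cedges c))" and ?O = "outside (curves (cedges c))"
  note J = cycle_Jordan[OF assms(2)]
  have "frontier F \<subseteq> closure ?I"
    using closure_mono[OF assms(3)] unfolding frontier_def by blast
  then have "curves A \<subseteq> ?I \<union> curves (cedges c)"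
    using assms(1) closure_Un_frontier[of ?I] J(3) by (metis subset_trans)
  then have disj: "?O \<inter> curves A = {}"
    using inside_Int_outside[of "curves (cedges c)"] outside_no_overlap[of "curves (cedges c)"] by blast
  fix z assume z: "z \<in> ?O"
  have "?O \<subseteq> connected_component_set (- curves A) z"
    using z J(1) disj by (intro connected_component_maximal) auto
  then have "\<not> bounded (connected_component_set (- curves A) z)"
    using J(2) bounded_subset by blast
  moreover have "z \<notin> curves A" using z disj by blast
  ultimately show "z \<in> outside (curves A)" unfolding outside_def by simp
qed

lemma cedges_subset_of_curves:
  assumes "is_cycle (parcs G) c" "is_cycle (parcs G) c'" "curves (cedges c) \<subseteq> curves (cedges c')"
  shows "cedges c \<subseteq> cedges c'"
proof (rule subrelI)
  fix u v assume uv: "(u, v) \<in> cedges c"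
  show "(u, v) \<in> cedges c'"
  proof (rule edge_curve_noncrossing)
    show "(u, v) \<in> parcs G" "cedges c' \<subseteq> parcs G" using uv assms(1,2) by (auto simp: is_cycle_def)
    show "path_image (\<gamma> (u, v)) \<subseteq> curves (cedges c')" using uv assms(3) by blast
  qed (rule sym_edges)
qed

lemma bounding_cycle:
  assumes F: "F \<in> faces G pos \<gamma>"
  obtains c where "is_cycle (parcs G) c" "bounding_cycle G pos \<gamma> F = \<lparr>pverts = set c, parcs = cedges c\<rparr>"
proof -
  obtain c where c: "is_cycle (parcs G) c" "curves (cedges c) \<subseteq> frontier F" "F \<subseteq> inside (curves (cedges c))"
    using face_has_cycle[OF F] by blast
  have "bounding_cycle G pos \<gamma> F = \<lparr>pverts = set c, parcs = cedges c\<rparr>"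
    unfolding bounding_cycle_def
  proof (rule the_equality)
    show "\<lparr>pverts = set c, parcs = cedges c\<rparr> \<in> cycle_subgraphs G \<and>
        drawing \<lparr>pverts = set c, parcs = cedges c\<rparr> pos \<gamma> \<subseteq> frontier F \<and>
        F \<subseteq> inside (drawing \<lparr>pverts = set c, parcs = cedges c\<rparr> pos \<gamma>)"
      unfolding drawing_cycle[OF c(1)] cycle_subgraphs_eq[OF graph] using c by blast
  next
    fix C
    assume C: "C \<in> cycle_subgraphs G \<and> drawing C pos \<gamma> \<subseteq> frontier F \<and> F \<subseteq> inside (drawing C pos \<gamma>)"
    then obtain c' where c': "C = \<lparr>pverts = set c', parcs = cedges c'\<rparr>" "is_cycle (parcs G) c'"
      unfolding cycle_subgraphs_eq[OF graph] by blast
    have d: "curves (cedges c') \<subseteq> frontier F" "F \<subseteq> inside (curves (cedges c'))"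
      using C[THEN conjunct2] unfolding c'(1) drawing_cycle[OF c'(2)] by (rule conjunct1, rule conjunct2)
    have "outside (curves (cedges c')) = outside (curves (cedges c))"
      using outside_cycle_subset[OF c(2) c'(2) d(2)] outside_cycle_subset[OF d(1) c(1) c(3)]
      by (rule subset_antisym)
    then have "curves (cedges c') = curves (cedges c)"
      using cycle_Jordan(4)[OF c(1)] cycle_Jordan(4)[OF c'(2)] by metis
    then have "cedges c' = cedges c"
      using cedges_subset_of_curves[OF c(1) c'(2)] cedges_subset_of_curves[OF c'(2) c(1)] by (metis order_refl subset_antisym)
    moreover from this have "set c' = set c" using Field_cedges c(1) c'(2) by metis
    ultimately show "C = \<lparr>pverts = set c, parcs = cedges c\<rparr>" using c'(1) by simp
  qed
  then show thesis using that c(1) by blast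
qed

section \<open>Strict face components\<close>

lemma strict_face_component_cycle_or_book:
  assumes "equal_cycles (parcs G) r" and F: "F \<in> faces G pos \<gamma>"
  defines "H \<equiv> strict_face_component G pos \<gamma> F"
  shows "equal_cycles.cycle_or_book (parcs G) r (parcs H)" "pverts H = Field (parcs H)"
proof -
  let ?R = "{F'. (F, F') \<in> (face_adjacency G pos \<gamma>)\<^sup>*}"
  \<comment> \<open>The reflexive closure adds no foreign sets because the chain starts at a
    face.\<close>
  have face: "F' \<in> faces G pos \<gamma>" if "(F, F') \<in> (face_adjacency G pos \<gamma>)\<^sup>*" for F'
    using that F by (induction rule: rtrancl_induct) (auto simp: face_adjacency_def)
  have bc: "\<exists>c. is_cycle (parcs G) c \<and> bounding_cycle G pos \<gamma> F' = \<lparr>pverts = set c, parcs = cedges c\<rparr>"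
    if "F' \<in> ?R" for F'
    using bounding_cycle[OF face] that by blast
  have H: "pverts H = (\<Union>F'\<in>?R. pverts (bounding_cycle G pos \<gamma> F'))"
    "parcs H = (\<Union>F'\<in>?R. parcs (bounding_cycle G pos \<gamma> F'))"
    by (simp_all add: H_def strict_face_component_def Let_def)
  have "pverts (bounding_cycle G pos \<gamma> F') = Field (parcs (bounding_cycle G pos \<gamma> F'))"
    if R: "F' \<in> ?R" for F'
  proof -
    obtain c where c: "is_cycle (parcs G) c" "bounding_cycle G pos \<gamma> F' = \<lparr>pverts = set c, parcs = cedges c\<rparr>"
      using bc[OF R] by (elim exE conjE)
    show ?thesis unfolding c(2) using Field_cedges[OF c(1)] by simp
  qed
  then have "pverts H = (\<Union>F'\<in>?R. Field (parcs (bounding_cycle G pos \<gamma> F')))"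
    unfolding H(1) by (rule SUP_cong[OF refl])
  then show "pverts H = Field (parcs H)" unfolding H(2) by (simp only: Field_Union image_image)
  show "equal_cycles.cycle_or_book (parcs G) r (parcs H)"
    unfolding H
  proof (rule equal_cycles.cycle_or_book_connected_Union[OF assms(1) finite_parcs])
    fix F' assume R: "(F, F') \<in> (face_adjacency G pos \<gamma>)\<^sup>*"
    obtain c where "is_cycle (parcs G) c" "bounding_cycle G pos \<gamma> F' = \<lparr>pverts = set c, parcs = cedges c\<rparr>"
      using bc[of F', OF CollectI, OF R] by (elim exE conjE)
    then show "\<exists>c. is_cycle (parcs G) c \<and> parcs (bounding_cycle G pos \<gamma> F') = cedges c"
      by (intro exI[of _ c]) simp
  next
    fix F' F''
    assume "(F', F'') \<in> face_adjacency G pos \<gamma>"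
    then show "parcs (bounding_cycle G pos \<gamma> F') \<inter> parcs (bounding_cycle G pos \<gamma> F'') \<noteq> {}"
      by (simp add: face_adjacency_def)
  qed
qed

end

theorem corollary3p13:
  fixes G :: "'a pair_pre_digraph"
    and pos :: "'a \<Rightarrow> complex"
    and \<gamma> :: "'a \<times> 'a \<Rightarrow> real \<Rightarrow> complex"
    and r :: nat
  assumes "pair_graph G"
    and "Digraph_Component.connected (with_proj G)"
    and "plane_representation G pos \<gamma>"
    and "cycle_lengths G \<noteq> {}"
    and "r = girth G" and "r = circum G"
  shows "(even r \<longrightarrow> (\<forall>H \<in> strict_face_components G pos \<gamma>.
            (\<exists>p\<ge>2. digraph_iso (with_proj H) (with_proj (book_graph (r div 2) r p))) \<or>
            digraph_iso (with_proj H) (with_proj (cycle_graph r)))) \<and>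
         (odd r \<longrightarrow> (\<forall>H \<in> strict_face_components G pos \<gamma>.
            digraph_iso (with_proj H) (with_proj (cycle_graph r))))"
proof -
  interpret plane_graph G pos \<gamma> by (rule plane_graph.intro) (fact assms)+
  have eq: "equal_cycles (parcs G) r" using equal_cycles_girth_circum assms(1,5,6) by blast
  \<comment> \<open>The book case forces \<open>r\<close> to be even, so a single disjunction
    settles both parities.\<close>
  have "digraph_iso (with_proj H) (with_proj (cycle_graph r)) \<or>
    (even r \<and> (\<exists>p\<ge>2. digraph_iso (with_proj H) (with_proj (book_graph (r div 2) r p))))"
    if "H \<in> strict_face_components G pos \<gamma>" for H
  proof -
    obtain F where F: "F \<in> faces G pos \<gamma>" "H = strict_face_component G pos \<gamma> F"
      using \<open>H \<in> strict_face_components G pos \<gamma>\<close> by (auto simp: strict_face_components_def)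
    note H = strict_face_component_cycle_or_book[OF eq F(1), folded F(2)]
    have "(\<exists>c. is_cycle (parcs G) c \<and> parcs H = cedges c) \<or>
        (\<exists>m u v P. r = 2 * m \<and> is_book m u v P (parcs H))"
      using H(1) unfolding equal_cycles.cycle_or_book_def[OF eq] by (rule conjunct2)
    then show ?thesis
    proof (elim disjE exE conjE)
      fix c assume c: "is_cycle (parcs G) c" "parcs H = cedges c"
      show ?thesis using cycle_iso[OF c(1) H(2) c(2)] equal_cycles.cycle_length[OF eq c(1)] by simp
    next
      fix m u v P assume r: "r = 2 * m" and P: "is_book m u v P (parcs H)"
      have "digraph_iso (with_proj H) (with_proj (book_graph (r div 2) r (card P - 1)))"
        using book_iso[OF P H(2)] r by simp
      \<comment> \<open>One of the at least three pages is the common path; the others count the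
        glued cycles.\<close>
      moreover have "2 \<le> card P - 1" using is_bookD(3)[OF P] by simp
      moreover have "even r" using r by simp
      ultimately show ?thesis by blast
    qed
  qed
  then show ?thesis by blast
qed

end
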